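(* Let $F=\sum_{(i,j,k)\in\Delta_n}F_{ijk}x^iy^jz^k\in\mathcal{H}_n(\mathbb{C}\{t\})$. Then $l(\partial(F))=\tfrac12\,\partial_0(l(F))$, where $l$ acts on each coordinate, so that $l(F)$ denotes the function $(i,j,k)\mapsto l(F_{ijk})$ on $\Delta_n$.
   Context: $\mathbb{C}\{t\}$ is the field of Puiseux series in $t^{-1}$, i.e. $\bigcup_{m\ge1}$ of the fields of Laurent series in $t^{-1/m}$ (finitely many positive powers of $t$) with complex coefficients that converge for all sufficiently large real $t$. $\mathbb{R}\{t\}\subset\mathbb{C}\{t\}$ is the subfield of series with real coefficients; it is a real closed ordered field in which the positive elements are the nonzero series whose leading term (the term with the largest exponent of $t$) has positive coefficient, and $\mathbb{C}\{t\}=\mathbb{R}\{t\}(\sqrt{-1})$. "Hermitian" and "positive definite" over $\mathbb{C}\{t\}$ are defined as over $\mathbb{C}$. The map $l:\mathbb{C}\{t\}^*\to\mathbb{Q}$ sends a series to the exponent of its leading term. $\Delta_n$ is the set of triples of nonnegative integers with sum $n$. $\mathcal{H}_n(\mathbb{C}\{t\})$ is the set of homogeneous degree $n$ polynomials in $\mathbb{R}\{t\}[x,y,z]$ of the form $\det(xX+yY+zZ)$ with $X,Y,Z$ positive definite Hermitian $n\times n$ matrices over $\mathbb{C}\{t\}$. All coefficients $F_{ijk}$, $(i,j,k)\in\Delta_n$, of such a polynomial are positive elements of $\mathbb{R}\{t\}$. For $F\in\mathcal{H}_n(\mathbb{C}\{t\})$, $\partial(F)$ is the triple of weakly decreasing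 $n$-tuples of positive elements of $\mathbb{R}\{t\}$ consisting of the positive square roots of the zeros in $u$ (with multiplicity; all zeros are positive elements of $\mathbb{R}\{t\}$) of $F(-1,u,0)$, $F(0,-1,u)$ and $F(u,0,-1)$ respectively. For a function $h$ on $\Delta_n$, $$\begin{aligned}\partial_0 h=\big(&(h_{(n-1)10}-h_{n00},\,h_{(n-2)20}-h_{(n-1)10},\ldots,h_{0n0}-h_{1(n-1)0}),\\&(h_{0(n-1)1}-h_{0n0},\,h_{0(n-2)2}-h_{0(n-1)1},\ldots,h_{00n}-h_{01(n-1)}),\\&(h_{10(n-1)}-h_{00n},\,h_{20(n-2)}-h_{10(n-1)},\ldots,h_{n00}-h_{(n-1)01})\big).\end{aligned}$$
   Formalization: The boundary ∂(F) is taken from the zeros of F(u,-1,0), F(0,u,-1), F(-1,0,u), the inverses of the zeros of F(-1,u,0), F(0,-1,u), F(u,0,-1); with the latter the identity fails already for n=1, F=tx+y+z (1/2 versus -1/2). *)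

theory Defs
  imports
    "HOL-Complex_Analysis.Laurent_Convergence"
    "Jordan_Normal_Form.Schur_Decomposition"
begin

section \<open>Convergent Puiseux series in \<open>1/t\<close>\<close>

text \<open>
  A series is represented by its coefficient function: \<^term>\<open>c q\<close> is the coefficient of \<open>t\<^sup>q\<close>.
  For some \<open>m\<close> all exponents lie in \<open>(1/m) \<int>\<close>, they are bounded above (by an integer \<open>N\<close>),
  and the series converges for all sufficiently large real \<open>t\<close>.
\<close>

definition is_puiseux :: "(rat \<Rightarrow> complex) \<Rightarrow> bool" where
  "is_puiseux c \<longleftrightarrow>
     (\<exists>m::nat. \<exists>N::int. m > 0 \<and>
        (\<forall>q. c q \<noteq> 0 \<longrightarrow> (\<exists>k::nat. q = of_int N - of_nat k / of_nat m)) \<and>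
        (\<forall>\<^sub>F t::real in at_top.
           summable (\<lambda>k::nat. c (of_int N - of_nat k / of_nat m) *
             of_real (t powr (of_int N - of_nat k / of_nat m)))))"

text \<open>
  The Laurent series \<open>F\<close> in \<open>s\<close>, after the substitution \<open>s = t\<^bsup>-1/m\<^esup>\<close>.
\<close>

definition laurent_coeffs :: "nat \<Rightarrow> complex fls \<Rightarrow> rat \<Rightarrow> complex" where
  "laurent_coeffs m F q =
     (if q * of_nat m \<in> \<int> then fls_nth F (- \<lfloor>q * of_nat m\<rfloor>) else 0)"

lemma laurent_coeffs_nth:
  assumes "m > 0"
  shows "laurent_coeffs m F (- (of_int n / of_nat m)) = fls_nth F n"
  using assms by (simp add: laurent_coeffs_def)

lemma laurent_coeffs_nonzeroE:
  assumes "laurent_coeffs m F q \<noteq> 0" "m > 0"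
  obtains n where "q = - (of_int n / of_nat m)" "fls_nth F n \<noteq> 0"
proof -
  from assms have "q * of_nat m \<in> \<int>" by (auto simp: laurent_coeffs_def split: if_splits)
  then obtain j where j: "q * of_nat m = of_int j" by (elim Ints_cases)
  have "q = - (of_int (-j) / of_nat m)"
    using j assms(2) by (simp add: field_simps)
  moreover have "fls_nth F (-j) \<noteq> 0"
    using assms(1) j by (auto simp: laurent_coeffs_def split: if_splits)
  ultimately show thesis using that by blast
qed

lemma laurent_coeffs_eqI:
  assumes "m > 0" "\<And>q. c q \<noteq> 0 \<Longrightarrow> q * of_nat m \<in> \<int>"
    and "\<And>n. c (- (of_int n / of_nat m)) = fls_nth F n"
  shows "c = laurent_coeffs m F"
proof
  fix q
  show "c q = laurent_coeffs m F q"
  proof (cases "q * of_nat m \<in> \<int>")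
    case True
    then obtain j where j: "q * of_nat m = of_int j" by (elim Ints_cases)
    have q: "q = - (of_int (-j) / of_nat m)"
      using j assms(1) by (simp add: field_simps)
    show ?thesis unfolding q using assms(3)[of "-j"] laurent_coeffs_nth[OF assms(1), of F "-j"] by simp
  next
    case False
    then show ?thesis using assms(2)[of q] by (auto simp: laurent_coeffs_def)
  qed
qed

lemma powr_split:
  assumes "t > (0::real)" "m > 0"
  shows "t powr (of_int N - of_nat k / of_nat m) =
           t powr of_int N * (t powr (- (1 / of_nat m))) ^ k"
proof -
  have "(t powr (- (1 / of_nat m))) ^ k = t powr (- (of_nat k / of_nat m))"
    using assms by (simp add: powr_realpow[symmetric] powr_powr)
  then show ?thesis using assms by (simp add: powr_add[symmetric])
qed

lemma is_puiseux_iff_laurent: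
  "is_puiseux c \<longleftrightarrow> (\<exists>m>0. \<exists>F. fls_conv_radius F > 0 \<and> c = laurent_coeffs m F)"
proof
  assume "is_puiseux c"
  then obtain m N where m: "m > 0"
    and supp: "\<And>q. c q \<noteq> 0 \<Longrightarrow> (\<exists>k::nat. q = of_int N - of_nat k / of_nat m)"
    and conv: "\<forall>\<^sub>F t::real in at_top.
           summable (\<lambda>k::nat. c (of_int N - of_nat k / of_nat m) *
             of_real (t powr (of_int N - of_nat k / of_nat m)))"
    unfolding is_puiseux_def by blast
  define a where "a = (\<lambda>k::nat. c (of_int N - of_nat k / of_nat m))"
  from eventually_happens[OF eventually_conj[OF conv eventually_gt_at_top[of 0]]]
  obtain t :: real where t: "t > 0"
    and s: "summable (\<lambda>k::nat. a k * of_real (t powr (of_int N - of_nat k / of_nat m)))"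
    by (auto simp: a_def)
  define z where "z = complex_of_real (t powr (- (1 / of_nat m)))"
  have "(\<lambda>k::nat. a k * of_real (t powr (of_int N - of_nat k / of_nat m))) =
        (\<lambda>k. of_real (t powr of_int N) * (a k * z ^ k))"
    by (simp only: powr_split[OF t m] z_def of_real_mult of_real_power mult_ac)
  with s t have "summable (\<lambda>k. a k * z ^ k)"
    by (simp add: summable_cmult_iff)
  from conv_radius_geI[OF this] have r: "conv_radius a \<ge> norm z" .
  have z: "norm z > 0" using t by (simp add: z_def)
  have ra: "conv_radius a > 0"
    using r z by (metis ereal_less(2) order_less_le_trans)
  define F where "F = fls_shift (N * int m) (fps_to_fls (Abs_fps a))"
  have "fls_conv_radius F > 0"
    using ra by (simp add: F_def fps_conv_radius_def)
  moreover have "c = laurent_coeffs m F"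
  proof (rule laurent_coeffs_eqI[OF m])
    fix q assume "c q \<noteq> 0"
    from supp[OF this] obtain k :: nat where "q = of_int N - of_nat k / of_nat m" by blast
    then have "q * of_nat m = of_int (N * int m - int k)" using m by (simp add: field_simps)
    then show "q * of_nat m \<in> \<int>" by (metis Ints_of_int)
  next
    fix n :: int
    show "c (- (of_int n / of_nat m)) = fls_nth F n"
    proof (cases "n + N * int m \<ge> 0")
      case True
      define k where "k = nat (n + N * int m)"
      have "int k = n + N * int m" using True by (simp add: k_def)
      then have "(of_nat k :: rat) = of_int n + of_int N * of_nat m"
        by (metis of_int_add of_int_mult of_int_of_nat_eq)
      then have "- (of_int n / of_nat m) = (of_int N - of_nat k / of_nat m :: rat)"
        using m by (simp add: field_simps)
      then show ?thesis using True by (simp add: F_def a_def k_def)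
    next
      case False
      have "c (- (of_int n / of_nat m)) = 0"
      proof (rule ccontr)
        assume "\<not> ?thesis"
        from supp[OF this] obtain k :: nat
          where "- (of_int n / of_nat m) = (of_int N - of_nat k / of_nat m :: rat)" by blast
        then have "(of_nat k :: rat) = of_int n + of_int N * of_nat m"
          using m by (simp add: field_simps)
        then have "(of_int (int k) :: rat) = of_int (n + N * int m)" by simp
        then have "int k = n + N * int m" by (simp only: of_int_eq_iff)
        with False show False by simp
      qed
      then show ?thesis using False by (simp add: F_def)
    qed
  qed
  ultimately show "\<exists>m>0. \<exists>F. fls_conv_radius F > 0 \<and> c = laurent_coeffs m F" using m by blast
next
  assume "\<exists>m>0. \<exists>F. fls_conv_radius F > 0 \<and> c = laurent_coeffs m F"
  then obtain m F where m: "m > 0" and F: "fls_conv_radius F > 0" and c: "c = laurent_coeffs m F"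
    by blast
  define N where "N = max 0 (- fls_subdegree F)"
  have N: "N * int m \<ge> - fls_subdegree F"
  proof -
    have "N * int m \<ge> N * 1" using m by (intro mult_left_mono) (auto simp: N_def)
    then show ?thesis by (simp add: N_def)
  qed
  have ck: "c (of_int N - of_nat k / of_nat m) = fls_nth F (int k - N * int m)" for k
  proof -
    have "of_int N - of_nat k / of_nat m = (- (of_int (int k - N * int m) / of_nat m) :: rat)"
      using m by (simp add: field_simps)
    then show ?thesis unfolding c by (simp only: laurent_coeffs_nth[OF m])
  qed
  define a where "a = (\<lambda>k::nat. fls_nth F (int k - N * int m))"
  have "conv_radius a = fls_conv_radius (fls_shift (- (N * int m)) F)"
    unfolding fls_conv_radius_def fps_conv_radius_def a_def by simp
  then have ra: "conv_radius a > 0" using F by simp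
  then obtain r :: real where r: "r > 0" "ereal r < conv_radius a"
    by (metis ereal_dense2 ereal_less(2))
  have "((\<lambda>t::real. t powr (- (1 / of_nat m))) \<longlongrightarrow> 0) at_top"
    using m by (intro tendsto_neg_powr filterlim_ident) auto
  then have "\<forall>\<^sub>F t::real in at_top. t powr (- (1 / of_nat m)) < r"
    using r(1) by (rule order_tendstoD)
  then have conv: "\<forall>\<^sub>F t::real in at_top.
           summable (\<lambda>k::nat. a k * of_real (t powr (of_int N - of_nat k / of_nat m)))"
    using eventually_gt_at_top[of 0]
  proof eventually_elim
    case (elim t)
    define z where "z = complex_of_real (t powr (- (1 / of_nat m)))"
    have "ereal (norm z) < conv_radius a"
      using elim r(2) by (simp add: z_def) (metis ereal_less_eq(3) less_imp_le order_le_less_trans)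
    then have "summable (\<lambda>k. a k * z ^ k)" by (rule summable_in_conv_radius)
    then have "summable (\<lambda>k. of_real (t powr of_int N) * (a k * z ^ k))" by (rule summable_mult)
    moreover have "(\<lambda>k::nat. a k * of_real (t powr (of_int N - of_nat k / of_nat m))) =
        (\<lambda>k. of_real (t powr of_int N) * (a k * z ^ k))"
      by (simp only: powr_split[OF elim(2) m] z_def of_real_mult of_real_power mult_ac)
    ultimately show ?case by simp
  qed
  have supp: "\<exists>k::nat. q = of_int N - of_nat k / of_nat m" if q: "c q \<noteq> 0" for q
  proof -
    from q m obtain n where n: "q = - (of_int n / of_nat m)" "fls_nth F n \<noteq> 0"
      unfolding c by (rule laurent_coeffs_nonzeroE)
    from n(2) have "n \<ge> fls_subdegree F" by (rule fls_subdegree_leI)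
    with N have "n + N * int m \<ge> 0" by simp
    then obtain k where "n + N * int m = int k" by (metis nonneg_int_cases)
    then have "(of_nat k :: rat) = of_int n + of_int N * of_nat m"
      by (metis of_int_add of_int_mult of_int_of_nat_eq)
    then have "q = of_int N - of_nat k / of_nat m" using m n(1) by (simp add: field_simps)
    then show ?thesis by blast
  qed
  show "is_puiseux c"
    unfolding is_puiseux_def
    by (rule exI[of _ m], rule exI[of _ N]) (use m supp conv in \<open>auto simp: ck a_def\<close>)
qed

lemma is_puiseuxI: "m > 0 \<Longrightarrow> fls_conv_radius F > 0 \<Longrightarrow> is_puiseux (laurent_coeffs m F)"
  using is_puiseux_iff_laurent by blast

lemma fls_conv_radius_compose_power_pos:
  assumes "fls_conv_radius F > 0" "d > 0"
  shows "fls_conv_radius (fls_compose_power F d) > 0"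
proof -
  define a where "a = (\<lambda>n. fls_nth F (int n))"
  define b where "b = (\<lambda>n. fls_nth (fls_compose_power F d) (int n))"
  have "conv_radius a > 0"
    using assms by (simp add: fls_conv_radius_def fps_conv_radius_def a_def)
  then obtain r :: real where r: "r > 0" "ereal r < conv_radius a"
    by (metis ereal_dense2 ereal_less(2))
  define w where "w = root d r"
  have w: "w > 0" "w ^ d = r" using r(1) assms(2) by (simp_all add: w_def)
  have "summable (\<lambda>n. a n * of_real r ^ n)"
    using r by (intro summable_in_conv_radius) simp
  moreover have "(\<lambda>n. a n * of_real r ^ n) = (\<lambda>n. b (d * n) * of_real w ^ (d * n))"
    using assms(2) w(2) by (simp add: a_def b_def fls_nth_compose_power power_mult flip: of_real_power)
  ultimately have "summable (\<lambda>n. b (d * n) * complex_of_real w ^ (d * n))" by simp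
  moreover have "summable (\<lambda>n. b (d * n) * complex_of_real w ^ (d * n)) \<longleftrightarrow>
      summable (\<lambda>n. b n * complex_of_real w ^ n)"
  proof (rule summable_mono_reindex)
    show "strict_mono ((*) d)" using assms(2) by (simp add: strict_mono_def)
    fix n assume "n \<notin> range ((*) d)"
    then have "\<not> d dvd n" by (auto simp: dvd_def)
    then show "b n * complex_of_real w ^ n = 0"
      using assms(2) by (simp add: b_def fls_nth_compose_power)
  qed
  ultimately have "conv_radius b \<ge> norm (complex_of_real w)" by (intro conv_radius_geI) simp
  then have "conv_radius b > 0" using w(1) by (simp add: order_less_le_trans[of 0 "ereal w"])
  then show ?thesis by (simp add: fls_conv_radius_def fps_conv_radius_def b_def)
qed

lemma laurent_coeffs_compose_power:
  assumes "m > 0" "d > 0"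
  shows "laurent_coeffs m F = laurent_coeffs (m * d) (fls_compose_power F d)"
proof (rule laurent_coeffs_eqI)
  show "m * d > 0" using assms by simp
next
  fix q assume "laurent_coeffs m F q \<noteq> 0"
  then have "q * of_nat m \<in> \<int>" by (auto simp: laurent_coeffs_def split: if_splits)
  then have "(q * of_nat m) * of_nat d \<in> \<int>" by (rule Ints_mult) simp
  then show "q * of_nat (m * d) \<in> \<int>" by (simp add: mult_ac)
next
  fix n :: int
  show "laurent_coeffs m F (- (of_int n / of_nat (m * d))) = fls_nth (fls_compose_power F d) n"
  proof (cases "int d dvd n")
    case True
    then obtain j where j: "n = int d * j" by blast
    have "- (of_int n / of_nat (m * d)) = (- (of_int j / of_nat m) :: rat)"
      using assms by (simp add: j field_simps)
    then show ?thesis using assms j by (simp add: laurent_coeffs_nth fls_nth_compose_power)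
  next
    case False
    have "laurent_coeffs m F (- (of_int n / of_nat (m * d))) = 0"
    proof (rule ccontr)
      assume "\<not> ?thesis"
      then obtain j where "- (of_int n / of_nat (m * d)) = (- (of_int j / of_nat m) :: rat)"
        using assms(1) by (rule laurent_coeffs_nonzeroE)
      then have "(of_int n :: rat) = of_int (int d * j)" using assms by (simp add: field_simps)
      then have "n = int d * j" by (simp only: of_int_eq_iff)
      with False show False by simp
    qed
    then show ?thesis using False assms by (simp add: fls_nth_compose_power)
  qed
qed

lemma laurent_coeffs_common2:
  assumes "is_puiseux c" "is_puiseux d"
  obtains m F G where "m > 0" "fls_conv_radius F > 0" "fls_conv_radius G > 0"
    "c = laurent_coeffs m F" "d = laurent_coeffs m G"
proof -
  from assms obtain k l F G where "k > 0" "l > 0" "fls_conv_radius F > 0" "fls_conv_radius G > 0"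
    "c = laurent_coeffs k F" "d = laurent_coeffs l G"
    by (auto simp: is_puiseux_iff_laurent)
  then show thesis
    using that[of "k * l" "fls_compose_power F l" "fls_compose_power G k"]
      laurent_coeffs_compose_power[of k l F] laurent_coeffs_compose_power[of l k G]
      fls_conv_radius_compose_power_pos[of F l] fls_conv_radius_compose_power_pos[of G k]
    by (simp add: mult.commute)
qed

lemma laurent_coeffs_common3:
  assumes "is_puiseux c" "is_puiseux d" "is_puiseux e"
  obtains m F G H where "m > 0" "fls_conv_radius F > 0" "fls_conv_radius G > 0"
    "fls_conv_radius H > 0"
    "c = laurent_coeffs m F" "d = laurent_coeffs m G" "e = laurent_coeffs m H"
proof -
  obtain k F G where 1: "k > 0" "fls_conv_radius F > 0" "fls_conv_radius G > 0"
    "c = laurent_coeffs k F" "d = laurent_coeffs k G"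
    using assms(1,2) by (rule laurent_coeffs_common2)
  from assms(3) obtain l H where 2: "l > 0" "fls_conv_radius H > 0" "e = laurent_coeffs l H"
    by (auto simp: is_puiseux_iff_laurent)
  show thesis
    using that[of "k * l" "fls_compose_power F l" "fls_compose_power G l" "fls_compose_power H k"]
      laurent_coeffs_compose_power[of k l] laurent_coeffs_compose_power[of l k H]
      fls_conv_radius_compose_power_pos 1 2
    by (simp add: mult.commute)
qed

lemma laurent_coeffs_0: "laurent_coeffs m 0 = (\<lambda>_. 0)"
  by (auto simp: laurent_coeffs_def)

lemma laurent_coeffs_1: "m > 0 \<Longrightarrow> laurent_coeffs m 1 = (\<lambda>q. if q = 0 then 1 else 0)"
  by (rule laurent_coeffs_eqI[symmetric]) (auto split: if_splits)

lemma laurent_coeffs_add: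
  "laurent_coeffs m (F + G) = (\<lambda>q. laurent_coeffs m F q + laurent_coeffs m G q)"
  by (auto simp: laurent_coeffs_def)

lemma laurent_coeffs_uminus: "laurent_coeffs m (- F) = (\<lambda>q. - laurent_coeffs m F q)"
  by (auto simp: laurent_coeffs_def)

lemma laurent_coeffs_inj:
  assumes "m > 0" "laurent_coeffs m F = laurent_coeffs m G"
  shows "F = G"
  by (rule fls_eqI) (metis assms laurent_coeffs_nth)

text \<open>
  For two series the sum below is finite, since both supports are bounded above and
  contained in a lattice \<open>(1/m) \<int>\<close>.
\<close>

definition cauchy_prod :: "(rat \<Rightarrow> complex) \<Rightarrow> (rat \<Rightarrow> complex) \<Rightarrow> rat \<Rightarrow> complex" where
  "cauchy_prod c d q = (\<Sum>p | c p \<noteq> 0 \<and> d (q - p) \<noteq> 0. c p * d (q - p))"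

lemma cauchy_prod_laurent:
  assumes "m > 0"
  shows "cauchy_prod (laurent_coeffs m F) (laurent_coeffs m G) = laurent_coeffs m (F * G)"
proof (rule laurent_coeffs_eqI[OF assms])
  fix q assume "cauchy_prod (laurent_coeffs m F) (laurent_coeffs m G) q \<noteq> 0"
  then have "{p. laurent_coeffs m F p \<noteq> 0 \<and> laurent_coeffs m G (q - p) \<noteq> 0} \<noteq> {}"
    unfolding cauchy_prod_def by (metis sum.empty)
  then obtain p where "laurent_coeffs m F p \<noteq> 0" "laurent_coeffs m G (q - p) \<noteq> 0" by blast
  then have "p * of_nat m \<in> \<int>" "(q - p) * of_nat m \<in> \<int>"
    by (auto simp: laurent_coeffs_def split: if_splits)
  then have "p * of_nat m + (q - p) * of_nat m \<in> \<int>" by (rule Ints_add)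
  then show "q * of_nat m \<in> \<int>" by (simp add: algebra_simps)
next
  fix n :: int
  let ?q = "- (of_int n / of_nat m) :: rat"
  let ?e = "\<lambda>i::int. - (of_int i / of_nat m) :: rat"
  let ?S = "{i. fls_nth F i \<noteq> 0 \<and> fls_nth G (n - i) \<noteq> 0}"
  have diff: "?q - ?e i = ?e (n - i)" for i
    using assms by (simp add: field_simps)
  have inj: "inj_on ?e ?S" using assms by (auto simp: inj_on_def)
  have "{p. laurent_coeffs m F p \<noteq> 0 \<and> laurent_coeffs m G (?q - p) \<noteq> 0} = ?e ` ?S"
  proof (intro equalityI subsetI)
    fix p assume "p \<in> {p. laurent_coeffs m F p \<noteq> 0 \<and> laurent_coeffs m G (?q - p) \<noteq> 0}"
    then have p: "laurent_coeffs m F p \<noteq> 0" "laurent_coeffs m G (?q - p) \<noteq> 0" by auto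
    from p(1) assms obtain i where i: "p = ?e i" "fls_nth F i \<noteq> 0"
      by (rule laurent_coeffs_nonzeroE)
    have "fls_nth G (n - i) \<noteq> 0"
      using p(2) unfolding i(1) diff laurent_coeffs_nth[OF assms] .
    with i show "p \<in> ?e ` ?S" by blast
  next
    fix p assume "p \<in> ?e ` ?S"
    then obtain i where i: "p = ?e i" "i \<in> ?S" by blast
    show "p \<in> {p. laurent_coeffs m F p \<noteq> 0 \<and> laurent_coeffs m G (?q - p) \<noteq> 0}"
      using i(2) unfolding i(1) mem_Collect_eq diff laurent_coeffs_nth[OF assms] .
  qed
  then have "cauchy_prod (laurent_coeffs m F) (laurent_coeffs m G) ?q =
      (\<Sum>i\<in>?S. laurent_coeffs m F (?e i) * laurent_coeffs m G (?q - ?e i))"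
    unfolding cauchy_prod_def by (simp only: sum.reindex[OF inj] o_def)
  also have "\<dots> = (\<Sum>i\<in>?S. fls_nth F i * fls_nth G (n - i))"
    by (simp only: diff laurent_coeffs_nth[OF assms])
  also have "\<dots> = (\<Sum>i=fls_subdegree F..n - fls_subdegree G. fls_nth F i * fls_nth G (n - i))"
  proof (rule sum.mono_neutral_left)
    show "?S \<subseteq> {fls_subdegree F..n - fls_subdegree G}"
    proof
      fix i assume "i \<in> ?S"
      then have "fls_subdegree F \<le> i" "fls_subdegree G \<le> n - i"
        by (auto intro: fls_subdegree_leI)
      then show "i \<in> {fls_subdegree F..n - fls_subdegree G}" by auto
    qed
  qed auto
  also have "\<dots> = fls_nth (F * G) n" by (simp only: fls_times_nth(2))
  finally show "cauchy_prod (laurent_coeffs m F) (laurent_coeffs m G) ?q = fls_nth (F * G) n" .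
qed

lemma fls_conv_radius_add_pos:
  "fls_conv_radius F > 0 \<Longrightarrow> fls_conv_radius G > 0 \<Longrightarrow> fls_conv_radius (F + G) > 0"
  by (rule less_le_trans[OF _ fls_conv_radius_add]) auto

lemma fls_conv_radius_mult_pos:
  "fls_conv_radius F > 0 \<Longrightarrow> fls_conv_radius G > 0 \<Longrightarrow> fls_conv_radius (F * G) > 0"
  by (rule less_le_trans[OF _ fls_conv_radius_mult]) auto

lemma fls_conv_radius_inverse_pos:
  assumes "fls_conv_radius F > 0"
  shows "fls_conv_radius (inverse F) > 0"
proof -
  have "eval_fls F has_laurent_expansion F"
    using assms by (simp add: has_laurent_expansion_def)
  then have "(\<lambda>z. inverse (eval_fls F z)) has_laurent_expansion inverse F"
    by (rule has_laurent_expansion_inverse)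
  then show ?thesis by (simp add: has_laurent_expansion_def)
qed

lemma cauchy_prod_assoc:
  assumes "is_puiseux c" "is_puiseux d" "is_puiseux e"
  shows "cauchy_prod (cauchy_prod c d) e = cauchy_prod c (cauchy_prod d e)"
proof -
  obtain m F G H where m: "m > 0"
    and cde: "c = laurent_coeffs m F" "d = laurent_coeffs m G" "e = laurent_coeffs m H"
    using assms by (rule laurent_coeffs_common3)
  show ?thesis unfolding cde cauchy_prod_laurent[OF m] by (simp only: mult.assoc)
qed

lemma cauchy_prod_commute:
  assumes "is_puiseux c" "is_puiseux d"
  shows "cauchy_prod c d = cauchy_prod d c"
proof -
  obtain m F G where m: "m > 0"
    and cd: "c = laurent_coeffs m F" "d = laurent_coeffs m G"
    using assms by (rule laurent_coeffs_common2)
  show ?thesis unfolding cd cauchy_prod_laurent[OF m] by (simp only: mult.commute)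
qed

lemma cauchy_prod_add_left:
  assumes "is_puiseux c" "is_puiseux d" "is_puiseux e"
  shows "cauchy_prod (\<lambda>q. c q + d q) e = (\<lambda>q. cauchy_prod c e q + cauchy_prod d e q)"
proof -
  obtain m F G H where m: "m > 0"
    and cde: "c = laurent_coeffs m F" "d = laurent_coeffs m G" "e = laurent_coeffs m H"
    using assms by (rule laurent_coeffs_common3)
  show ?thesis
    unfolding cde laurent_coeffs_add[symmetric] cauchy_prod_laurent[OF m]
    by (simp only: distrib_right)
qed

lemma cauchy_prod_inverse:
  assumes "is_puiseux c" "c \<noteq> (\<lambda>_. 0)"
  shows "\<exists>d\<in>Collect is_puiseux. cauchy_prod c d = (\<lambda>q. if q = 0 then 1 else 0)"
proof -
  obtain m F where m: "m > 0" and F: "fls_conv_radius F > 0" and c: "c = laurent_coeffs m F"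
    using assms(1) unfolding is_puiseux_iff_laurent by blast
  have "F \<noteq> 0" using assms(2) unfolding c by (rule contrapos_nn) (simp only: laurent_coeffs_0)
  then have "F * inverse F = 1" by (rule right_inverse)
  then have "cauchy_prod c (laurent_coeffs m (inverse F)) = (\<lambda>q. if q = 0 then 1 else 0)"
    unfolding c cauchy_prod_laurent[OF m] by (simp only: laurent_coeffs_1[OF m])
  moreover have "laurent_coeffs m (inverse F) \<in> Collect is_puiseux"
    using is_puiseuxI[OF m fls_conv_radius_inverse_pos[OF F]] by simp
  ultimately show ?thesis by (rule bexI)
qed

subsection \<open>The field\<close>

typedef puiseux = "{c. is_puiseux c}"
  morphisms pcoeff Abs_puiseux
  using is_puiseuxI[of 1 0] by auto

setup_lifting type_definition_puiseux

lemma pcoeff_is_puiseux: "is_puiseux (pcoeff x)"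
  using pcoeff by simp

instantiation puiseux :: field
begin

lift_definition zero_puiseux :: puiseux is "\<lambda>_. 0"
  using is_puiseuxI[of 1 0] by (simp add: laurent_coeffs_0)

lift_definition one_puiseux :: puiseux is "\<lambda>q. if q = 0 then 1 else 0"
  using is_puiseuxI[of 1 1] by (simp add: laurent_coeffs_1)

lift_definition plus_puiseux :: "puiseux \<Rightarrow> puiseux \<Rightarrow> puiseux" is "\<lambda>c d q. c q + d q"
  by (erule (1) laurent_coeffs_common2)
     (simp add: is_puiseuxI fls_conv_radius_add_pos flip: laurent_coeffs_add)

lift_definition uminus_puiseux :: "puiseux \<Rightarrow> puiseux" is "\<lambda>c q. - c q"
proof -
  fix c assume "is_puiseux c"
  then obtain m F where "m > 0" "fls_conv_radius F > 0" "c = laurent_coeffs m F"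
    by (auto simp: is_puiseux_iff_laurent)
  then show "is_puiseux (\<lambda>q. - c q)"
    using is_puiseuxI[of m "- F"] by (simp add: laurent_coeffs_uminus)
qed

definition minus_puiseux :: "puiseux \<Rightarrow> puiseux \<Rightarrow> puiseux" where
  "minus_puiseux x y = x + (- y)"

lift_definition times_puiseux :: "puiseux \<Rightarrow> puiseux \<Rightarrow> puiseux" is cauchy_prod
  by (erule (1) laurent_coeffs_common2)
     (simp add: is_puiseuxI fls_conv_radius_mult_pos cauchy_prod_laurent)

definition inverse_puiseux :: "puiseux \<Rightarrow> puiseux" where
  "inverse_puiseux x = (if x = 0 then 0 else THE y. x * y = 1)"

definition divide_puiseux :: "puiseux \<Rightarrow> puiseux \<Rightarrow> puiseux" where
  "divide_puiseux x y = x * inverse y"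

instance
proof
  fix x y z :: puiseux
  show "x + y + z = x + (y + z)" by transfer (simp add: add.assoc)
  show "x + y = y + x" by transfer (simp add: add.commute)
  show "0 + x = x" by transfer simp
  show "- x + x = 0" by transfer simp
  show "x - y = x + - y" by (simp add: minus_puiseux_def)
  show "(0::puiseux) \<noteq> 1" by transfer (auto simp: fun_eq_iff)
  show assoc: "x * y * z = x * (y * z)" for x y z :: puiseux
    by transfer (rule cauchy_prod_assoc)
  show comm: "x * y = y * x" for x y :: puiseux
    by transfer (rule cauchy_prod_commute)
  show one: "1 * x = x" for x :: puiseux
  proof transfer
    fix c assume "is_puiseux c"
    then obtain m F where mF: "m > 0" "c = laurent_coeffs m F"
      by (auto simp: is_puiseux_iff_laurent)
    show "cauchy_prod (\<lambda>q. if q = 0 then 1 else 0) c = c"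
      unfolding mF(2) laurent_coeffs_1[OF mF(1), symmetric] cauchy_prod_laurent[OF mF(1)] by simp
  qed
  show "(x + y) * z = x * z + y * z"
    by transfer (rule cauchy_prod_add_left)
  show "inverse x * x = 1" if "x \<noteq> 0"
  proof -
    have "\<exists>y. x * y = 1" using that by transfer (rule cauchy_prod_inverse)
    then obtain y where y: "x * y = 1" by blast
    have "z = y" if z: "x * z = 1" for z
    proof -
      have "z = 1 * z" by (simp only: one)
      also have "\<dots> = (y * x) * z" by (simp only: comm[of y x] y)
      also have "\<dots> = y * 1" by (simp only: assoc z)
      also have "\<dots> = y" by (simp only: comm[of y 1] one)
      finally show ?thesis .
    qed
    with y have "(THE y. x * y = 1) = y" by (rule the_equality)
    with that have inv: "inverse x = y" by (simp only: inverse_puiseux_def if_False)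
    show ?thesis unfolding inv by (simp only: comm[of y x] y)
  qed
  show "x div y = x * inverse y" by (simp add: divide_puiseux_def)
  show "inverse (0::puiseux) = 0" by (simp add: inverse_puiseux_def)
qed

end

subsection \<open>Leading terms, the real subfield and the order\<close>

definition puiseux_l :: "puiseux \<Rightarrow> rat" where
  "puiseux_l x = (GREATEST q. pcoeff x q \<noteq> 0)"

definition puiseux_lc :: "puiseux \<Rightarrow> complex" where
  "puiseux_lc x = pcoeff x (puiseux_l x)"

definition real_puiseux :: "puiseux set" where
  "real_puiseux = {x. \<forall>q. pcoeff x q \<in> \<real>}"

definition puiseux_pos :: "puiseux \<Rightarrow> bool" where
  "puiseux_pos x \<longleftrightarrow> x \<in> real_puiseux \<and> x \<noteq> 0 \<and> Re (puiseux_lc x) > 0"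

lemma puiseux_l_eqI:
  assumes "pcoeff x q \<noteq> 0" "\<And>p. p > q \<Longrightarrow> pcoeff x p = 0"
  shows "puiseux_l x = q"
  unfolding puiseux_l_def by (rule Greatest_equality) (use assms in \<open>auto simp: not_less[symmetric]\<close>)

lemma puiseux_leading_laurent:
  assumes "pcoeff x = laurent_coeffs m F" "m > 0" "F \<noteq> 0"
  shows "puiseux_l x = - (of_int (fls_subdegree F) / of_nat m)"
    and "puiseux_lc x = fls_nth F (fls_subdegree F)"
proof -
  show 1: "puiseux_l x = - (of_int (fls_subdegree F) / of_nat m)"
  proof (rule puiseux_l_eqI)
    show "pcoeff x (- (of_int (fls_subdegree F) / of_nat m)) \<noteq> 0"
      using assms by (simp add: laurent_coeffs_nth)
    fix p :: rat assume p: "- (of_int (fls_subdegree F) / of_nat m) < p"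
    show "pcoeff x p = 0"
    proof (rule ccontr)
      assume "pcoeff x p \<noteq> 0"
      then obtain n where n: "p = - (of_int n / of_nat m)" "fls_nth F n \<noteq> 0"
        using assms(1,2) by (metis laurent_coeffs_nonzeroE)
      from n(2) have "fls_subdegree F \<le> n" by (rule fls_subdegree_leI)
      with p n(1) assms(2) show False by (simp add: divide_less_cancel)
    qed
  qed
  show "puiseux_lc x = fls_nth F (fls_subdegree F)"
    unfolding puiseux_lc_def 1 using assms by (simp add: laurent_coeffs_nth)
qed

lemma pcoeff_laurentE:
  obtains m F where "m > 0" "pcoeff x = laurent_coeffs m F" "x \<noteq> 0 \<Longrightarrow> F \<noteq> 0"
proof -
  from pcoeff_is_puiseux[of x] obtain m F where "m > 0" "pcoeff x = laurent_coeffs m F"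
    by (auto simp: is_puiseux_iff_laurent)
  moreover from this have "x \<noteq> 0 \<Longrightarrow> F \<noteq> 0"
    by (auto simp: laurent_coeffs_0 pcoeff_inject[symmetric] zero_puiseux.rep_eq)
  ultimately show thesis using that by blast
qed

lemma puiseux_l_greatest:
  assumes "x \<noteq> 0"
  shows "puiseux_lc x \<noteq> 0" and "p > puiseux_l x \<Longrightarrow> pcoeff x p = 0"
proof -
  obtain m F where mF: "m > 0" "pcoeff x = laurent_coeffs m F" "F \<noteq> 0"
    using pcoeff_laurentE[of x] assms by metis
  show "puiseux_lc x \<noteq> 0" using puiseux_leading_laurent[OF mF(2,1,3)] mF(3) by simp
  assume p: "p > puiseux_l x"
  show "pcoeff x p = 0"
  proof (rule ccontr)
    assume "pcoeff x p \<noteq> 0"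
    then obtain n where n: "p = - (of_int n / of_nat m)" "fls_nth F n \<noteq> 0"
      using mF by (metis laurent_coeffs_nonzeroE)
    from n(2) have "fls_subdegree F \<le> n" by (rule fls_subdegree_leI)
    with p n(1) mF show False by (simp add: puiseux_leading_laurent divide_less_cancel)
  qed
qed

lemma puiseux_mult_leading:
  assumes "x \<noteq> 0" "y \<noteq> 0"
  shows "puiseux_l (x * y) = puiseux_l x + puiseux_l y"
    and "puiseux_lc (x * y) = puiseux_lc x * puiseux_lc y"
proof -
  obtain m F G where m: "m > 0" "pcoeff x = laurent_coeffs m F" "pcoeff y = laurent_coeffs m G"
    using laurent_coeffs_common2[OF pcoeff_is_puiseux[of x] pcoeff_is_puiseux[of y]] by metis
  have nz: "F \<noteq> 0" "G \<noteq> 0"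
    using m(2,3) assms by (auto simp: laurent_coeffs_0 pcoeff_inject[symmetric] zero_puiseux.rep_eq)
  have xy: "pcoeff (x * y) = laurent_coeffs m (F * G)"
    using m by (simp add: times_puiseux.rep_eq cauchy_prod_laurent)
  show "puiseux_l (x * y) = puiseux_l x + puiseux_l y"
    using puiseux_leading_laurent(1)[OF xy m(1)] puiseux_leading_laurent(1)[OF m(2,1)]
      puiseux_leading_laurent(1)[OF m(3,1)] nz m(1) by (simp add: add_divide_distrib)
  show "puiseux_lc (x * y) = puiseux_lc x * puiseux_lc y"
    using puiseux_leading_laurent(2)[OF xy m(1)] puiseux_leading_laurent(2)[OF m(2,1)]
      puiseux_leading_laurent(2)[OF m(3,1)] nz
      by (simp add: fls_times_nth(2))
qed

lemma puiseux_pos_add: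
  assumes "puiseux_pos x" "puiseux_pos y"
  shows "puiseux_pos (x + y)"
proof -
  have x: "x \<noteq> 0" "Re (puiseux_lc x) > 0" "\<And>q. pcoeff x q \<in> \<real>"
    and y: "y \<noteq> 0" "Re (puiseux_lc y) > 0" "\<And>q. pcoeff y q \<in> \<real>"
    using assms by (auto simp: puiseux_pos_def real_puiseux_def)
  define q where "q = max (puiseux_l x) (puiseux_l y)"
  have re: "Re (pcoeff (x + y) q) > 0"
    using x(2) y(2) puiseux_l_greatest(2)[OF x(1)] puiseux_l_greatest(2)[OF y(1)]
    unfolding q_def puiseux_lc_def plus_puiseux.rep_eq
    by (cases "puiseux_l x" "puiseux_l y" rule: linorder_cases) auto
  have "puiseux_l (x + y) = q"
  proof (rule puiseux_l_eqI)
    show "pcoeff (x + y) q \<noteq> 0" using re by auto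
    show "pcoeff (x + y) p = 0" if "p > q" for p
      using that puiseux_l_greatest(2)[OF x(1), of p] puiseux_l_greatest(2)[OF y(1), of p]
      by (simp add: q_def plus_puiseux.rep_eq)
  qed
  moreover have "x + y \<noteq> 0" using re by (auto simp: zero_puiseux.rep_eq)
  ultimately show ?thesis
    using re x(3) y(3) by (auto simp: puiseux_pos_def real_puiseux_def puiseux_lc_def plus_puiseux.rep_eq)
qed

lemma puiseux_lc_uminus: "puiseux_lc (- x) = - puiseux_lc x"
  by (simp add: puiseux_lc_def puiseux_l_def uminus_puiseux.rep_eq)

lemma not_puiseux_pos_uminus: "puiseux_pos x \<Longrightarrow> \<not> puiseux_pos (- x)"
  by (auto simp: puiseux_pos_def puiseux_lc_uminus)

text \<open>
  As for \<^typ>\<open>complex\<close>, the order is partial: \<open>x \<le> y\<close> iff \<open>y - x\<close> is zero or a positive real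
  series.  In particular every \<open>x > 0\<close> has real coefficients.
\<close>

instantiation puiseux :: order
begin

definition less_puiseux :: "puiseux \<Rightarrow> puiseux \<Rightarrow> bool" where
  "less_puiseux x y \<longleftrightarrow> puiseux_pos (y - x)"

definition less_eq_puiseux :: "puiseux \<Rightarrow> puiseux \<Rightarrow> bool" where
  "less_eq_puiseux x y \<longleftrightarrow> x = y \<or> puiseux_pos (y - x)"

instance
proof
  fix x y z :: puiseux
  have anti: "\<not> (puiseux_pos (y - x) \<and> puiseux_pos (x - y))"
    using not_puiseux_pos_uminus[of "y - x"] by auto
  have irrefl: "\<not> puiseux_pos 0" by (simp add: puiseux_pos_def)
  show "x < y \<longleftrightarrow> x \<le> y \<and> \<not> y \<le> x"
    using anti irrefl by (auto simp: less_puiseux_def less_eq_puiseux_def)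
  show "x \<le> x" by (simp add: less_eq_puiseux_def)
  show "x \<le> y \<Longrightarrow> y \<le> z \<Longrightarrow> x \<le> z"
    using puiseux_pos_add[of "y - x" "z - y"] by (auto simp: less_eq_puiseux_def)
  show "x \<le> y \<Longrightarrow> y \<le> x \<Longrightarrow> x = y"
    using anti by (auto simp: less_eq_puiseux_def)
qed

end

subsection \<open>Conjugation\<close>

lemma is_puiseux_cnj:
  assumes "is_puiseux c"
  shows "is_puiseux (\<lambda>q. cnj (c q))"
proof -
  obtain m N where m: "m > 0"
    and supp: "\<forall>q. c q \<noteq> 0 \<longrightarrow> (\<exists>k::nat. q = of_int N - of_nat k / of_nat m)"
    and conv: "\<forall>\<^sub>F t::real in at_top.
           summable (\<lambda>k::nat. c (of_int N - of_nat k / of_nat m) *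
             of_real (t powr (of_int N - of_nat k / of_nat m)))"
    using assms unfolding is_puiseux_def by blast
  have cnj: "summable (\<lambda>k::nat. cnj (f k) * of_real (g k))"
    if s: "summable (\<lambda>k::nat. f k * of_real (g k))" for f g
  proof -
    from s obtain l where "(\<lambda>k. f k * of_real (g k)) sums l" unfolding summable_def ..
    then have "(\<lambda>k. cnj (f k * of_real (g k))) sums cnj l" by (simp only: sums_cnj)
    then have "(\<lambda>k. cnj (f k) * of_real (g k)) sums cnj l"
      by (simp only: complex_cnj_mult complex_cnj_complex_of_real)
    then show ?thesis by (rule sums_summable)
  qed
  have "\<forall>\<^sub>F t::real in at_top.
           summable (\<lambda>k::nat. cnj (c (of_int N - of_nat k / of_nat m)) *
             of_real (t powr (of_int N - of_nat k / of_nat m)))"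
    using conv by (rule eventually_mono) (rule cnj)
  then show ?thesis
    unfolding is_puiseux_def using m supp by (intro exI[of _ m] exI[of _ N]) simp
qed

instantiation puiseux :: conjugatable_ordered_field
begin

lift_definition conjugate_puiseux :: "puiseux \<Rightarrow> puiseux" is "\<lambda>c q. cnj (c q)"
  by (rule is_puiseux_cnj)

instance
proof
  fix x y z :: puiseux
  show id: "conjugate (conjugate x) = x" for x :: puiseux by transfer simp
  show "conjugate x = conjugate y \<longleftrightarrow> x = y" by (metis id)
  show mul: "conjugate (x * y) = conjugate x * conjugate y" for x y :: puiseux
    by transfer (simp add: cauchy_prod_def fun_eq_iff)
  show "conjugate (x + y) = conjugate x + conjugate y" by transfer simp
  show "conjugate (- x) = - conjugate x" by transfer simp
  show zero: "conjugate (0::puiseux) = 0" by transfer simp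
  show "x \<le> y \<Longrightarrow> z + x \<le> z + y" by (auto simp: less_eq_puiseux_def)
  show "x * conjugate x \<ge> 0"
  proof (cases "x = 0")
    case False
    then have nz: "conjugate x \<noteq> 0" by (metis id zero)
    have "conjugate (x * conjugate x) = x * conjugate x" by (simp add: mul id mult.commute)
    then have "cnj (pcoeff (x * conjugate x) q) = pcoeff (x * conjugate x) q" for q
      by (metis conjugate_puiseux.rep_eq)
    then have "x * conjugate x \<in> real_puiseux"
      by (auto simp: real_puiseux_def Reals_cnj_iff)
    moreover have "puiseux_lc (conjugate x) = cnj (puiseux_lc x)"
      by (simp add: puiseux_lc_def puiseux_l_def conjugate_puiseux.rep_eq)
    then have "puiseux_lc (x * conjugate x) = of_real ((cmod (puiseux_lc x))\<^sup>2)"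
      by (simp only: puiseux_mult_leading(2)[OF False nz] complex_norm_square)
    then have "Re (puiseux_lc (x * conjugate x)) > 0"
      using puiseux_l_greatest(1)[OF False] by simp
    ultimately show ?thesis using False nz by (simp add: less_eq_puiseux_def puiseux_pos_def)
  qed (simp add: less_eq_puiseux_def)
qed

end

section \<open>Determinantal polynomials\<close>

text \<open>
  The polynomial ring in \<open>x\<close>, \<open>y\<close>, \<open>z\<close> is the iterated one, \<open>((R[x])[y])[z]\<close>: the outermost
  variable is \<open>z\<close>.
\<close>

type_synonym 'a poly3 = "'a poly poly poly"

definition var_x :: "'a::comm_ring_1 poly3" where "var_x = [:[:[:0, 1:]:]:]"
definition var_y :: "'a::comm_ring_1 poly3" where "var_y = [:[:0, 1:]:]"
definition var_z :: "'a::comm_ring_1 poly3" where "var_z = [:0, 1:]"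
definition const3 :: "'a::comm_ring_1 \<Rightarrow> 'a poly3" where "const3 a = [:[:[:a:]:]:]"

definition coeff3 :: "'a::comm_ring_1 poly3 \<Rightarrow> nat \<Rightarrow> nat \<Rightarrow> nat \<Rightarrow> 'a" where
  "coeff3 F i j k = coeff (coeff (coeff F k) j) i"

text \<open>Substitution of univariate polynomials \<open>a\<close>, \<open>b\<close>, \<open>c\<close> for \<open>x\<close>, \<open>y\<close>, \<open>z\<close>.\<close>

definition subst3 :: "'a::comm_ring_1 poly3 \<Rightarrow> 'a poly \<Rightarrow> 'a poly \<Rightarrow> 'a poly \<Rightarrow> 'a poly" where
  "subst3 F a b c = poly (map_poly (\<lambda>G. poly (map_poly (\<lambda>h. pcompose h a) G) b) F) c"

definition hermitian :: "'a::conjugatable_field mat \<Rightarrow> bool" where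
  "hermitian A \<longleftrightarrow> mat_adjoint A = A"

definition positive_definite :: "nat \<Rightarrow> 'a::conjugatable_ordered_field mat \<Rightarrow> bool" where
  "positive_definite n A \<longleftrightarrow> A \<in> carrier_mat n n \<and> hermitian A \<and>
     (\<forall>v\<in>carrier_vec n. v \<noteq> 0\<^sub>v n \<longrightarrow> (A *\<^sub>v v) \<bullet>c v > 0)"

definition pencil :: "'a::comm_ring_1 mat \<Rightarrow> 'a mat \<Rightarrow> 'a mat \<Rightarrow> 'a poly3 mat" where
  "pencil X Y Z =
     var_x \<cdot>\<^sub>m map_mat const3 X + var_y \<cdot>\<^sub>m map_mat const3 Y + var_z \<cdot>\<^sub>m map_mat const3 Z"

definition H_polys :: "nat \<Rightarrow> puiseux poly3 set" where
  "H_polys n = {F.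
     (\<forall>i j k. coeff3 F i j k \<in> real_puiseux) \<and>
     (\<forall>i j k. coeff3 F i j k \<noteq> 0 \<longrightarrow> i + j + k = n) \<and>
     (\<exists>X Y Z. positive_definite n X \<and> positive_definite n Y \<and> positive_definite n Z \<and>
        F = Determinant.det (pencil X Y Z))}"

section \<open>The boundary maps\<close>

text \<open>
  The weakly decreasing list of the positive square roots of the roots of \<open>p\<close>, with multiplicity.
  For \<open>p \<noteq> 0\<close> at most one list has these properties; it exists iff all roots of \<open>p\<close> are positive.
\<close>

definition decreasing_sqrt_roots :: "puiseux poly \<Rightarrow> puiseux list" where
  "decreasing_sqrt_roots p =
     (THE as. (\<forall>a\<in>set as. a > 0) \<and> sorted_wrt (\<ge>) as \<and> mset (map (\<lambda>a. a\<^sup>2) as) = proots p)"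

text \<open>
  Orientation: the zeros are those of \<open>F(u,-1,0)\<close>, \<open>F(0,u,-1)\<close>, \<open>F(-1,0,u)\<close>.  The polynomials
  \<open>F(-1,u,0)\<close>, \<open>F(0,-1,u)\<close>, \<open>F(u,0,-1)\<close> have the inverse zeros; using those instead would reverse
  each of the three tuples and replace every entry by its inverse.  Only the present choice fits
  the signs in \<open>hive_boundary\<close> below: for \<open>n = 1\<close> and \<open>F = a x + b y + c z\<close>, the zero of \<open>F(u,-1,0)\<close>
  is \<open>b / a\<close>, and the corresponding difference is \<open>h\<^sub>0\<^sub>1\<^sub>0 - h\<^sub>1\<^sub>0\<^sub>0 = l(b) - l(a)\<close>.
\<close>

definition boundary :: "puiseux poly3 \<Rightarrow> puiseux list \<times> puiseux list \<times> puiseux list" where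
  "boundary F =
     (let u = [:0, 1:] in
       (decreasing_sqrt_roots (subst3 F u (-1) 0),
        decreasing_sqrt_roots (subst3 F 0 u (-1)),
        decreasing_sqrt_roots (subst3 F (-1) 0 u)))"

definition hive_boundary ::
    "nat \<Rightarrow> (nat \<Rightarrow> nat \<Rightarrow> nat \<Rightarrow> rat) \<Rightarrow> rat list \<times> rat list \<times> rat list" where
  "hive_boundary n h =
     (map (\<lambda>s. h (n - (s + 1)) (s + 1) 0 - h (n - s) s 0) [0..<n],
      map (\<lambda>s. h 0 (n - (s + 1)) (s + 1) - h 0 (n - s) s) [0..<n],
      map (\<lambda>s. h (s + 1) 0 (n - (s + 1)) - h s 0 (n - s)) [0..<n])"

definition map_triple :: "('a \<Rightarrow> 'b) \<Rightarrow> 'a list \<times> 'a list \<times> 'a list \<Rightarrow> 'b list \<times> 'b list \<times> 'b list"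
  where "map_triple f = map_prod (map f) (map_prod (map f) (map f))"

end

theory Submission
  imports Defs "HOL-Computational_Algebra.Field_as_Ring"
begin

text \<open>
  Setting one variable of \<open>F = det (x X + y Y + z Z)\<close> to zero gives a polynomial \<open>det (u P - Q)\<close> with
  \<open>P\<close>, \<open>Q\<close> positive definite.  If \<open>u\<close> is a zero and \<open>v\<close> a kernel vector, then \<open>u\<close> is the quotient of
  the positive values of the Hermitian forms \<open>Q\<close> and \<open>P\<close> at \<open>v\<close>; so every zero is a positive real
  series (\<open>positive_definite_pencil_singular\<close>).  Up to sign and the common factor \<open>det P\<close>, the
  coefficients of the polynomial are the elementary symmetric polynomials in its zeros.  Being sums of
  products of positive series they show no cancellation of leading terms: the leading exponent of the
  \<open>s\<close>-th one is the sum of those of the \<open>s\<close> largest zeros (\<open>puiseux_pos_prod_coeff\<close>).  Differences of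
  successive leading exponents of coefficients are therefore the leading exponents of the single zeros
  in decreasing order, and those of their square roots are half of that.

  This needs that the polynomial splits and that positive series have square roots.  Both follow from
  the Newton--Puiseux theorem, that the field is algebraically closed.  Its proof here takes a monic
  polynomial without a term of second highest degree, rescales the unknown by a power of \<open>t\<close> so that
  the coefficients become integral while the residue polynomial has two different roots, and then lifts
  a coprime factorisation of the residue polynomial by Hensel's lemma (\<open>puiseux_hensel\<close>).
  As the series in question converge, so must the lifted factors, which is proved with a quadratic
  majorant (\<open>hensel_convergent\<close>, \<open>quadratic_majorant_summable\<close>).
\<close>

section \<open>Hensel's lemma for convergent power series of polynomials\<close>

definition l1_norm :: "complex poly \<Rightarrow> real" where
  "l1_norm p = (\<Sum>i\<le>degree p. norm (coeff p i))"

lemma l1_norm_eq_sum: "degree p \<le> n \<Longrightarrow> l1_norm p = (\<Sum>i\<le>n. norm (coeff p i))"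
  unfolding l1_norm_def by (rule sum.mono_neutral_left) (auto simp: coeff_eq_0)

lemma l1_norm_nonneg [simp]: "l1_norm p \<ge> 0"
  by (simp add: l1_norm_def sum_nonneg)

lemma l1_norm_0 [simp]: "l1_norm 0 = 0"
  by (simp add: l1_norm_def)

lemma norm_coeff_le_l1_norm: "norm (coeff p i) \<le> l1_norm p"
  using l1_norm_eq_sum[of p "max i (degree p)"]
    member_le_sum[of i "{..max i (degree p)}" "\<lambda>i. norm (coeff p i)"] by simp

lemma l1_norm_add: "l1_norm (p + q) \<le> l1_norm p + l1_norm q"
proof -
  define n where "n = max (degree p) (degree q)"
  have "l1_norm (p + q) = (\<Sum>i\<le>n. norm (coeff p i + coeff q i))"
    by (subst l1_norm_eq_sum[of _ n]) (simp_all add: n_def degree_add_le_max)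
  also have "\<dots> \<le> (\<Sum>i\<le>n. norm (coeff p i) + norm (coeff q i))"
    by (intro sum_mono norm_triangle_ineq)
  finally show ?thesis
    by (simp add: sum.distrib l1_norm_eq_sum[of p n] l1_norm_eq_sum[of q n] n_def)
qed

lemma l1_norm_smult: "l1_norm (Polynomial.smult c p) = norm c * l1_norm p"
  by (subst l1_norm_eq_sum[of _ "degree p"]) (simp_all add: l1_norm_def norm_mult sum_distrib_left)

lemma l1_norm_uminus [simp]: "l1_norm (- p) = l1_norm p"
  by (simp add: l1_norm_def)

lemma l1_norm_diff: "l1_norm (p - q) \<le> l1_norm p + l1_norm q"
  using l1_norm_add[of p "- q"] by simp

lemma l1_norm_sum: "l1_norm (\<Sum>i\<in>A. f i) \<le> (\<Sum>i\<in>A. l1_norm (f i))"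
proof (induction A rule: infinite_finite_induct)
  case (insert a A)
  then show ?case using l1_norm_add[of "f a" "sum f A"] by simp
qed simp_all

lemma l1_norm_pCons: "l1_norm (pCons a p) = norm a + l1_norm p"
  by (subst l1_norm_eq_sum[of _ "Suc (degree p)"])
     (simp_all add: degree_pCons_le l1_norm_def sum.atMost_Suc_shift del: sum.atMost_Suc)

lemma l1_norm_mult: "l1_norm (p * q) \<le> l1_norm p * l1_norm q"
proof (induction p)
  case (pCons a p)
  have "l1_norm (pCons a p * q) \<le> l1_norm (Polynomial.smult a q) + l1_norm (pCons 0 (p * q))"
    by (simp add: l1_norm_add)
  also have "\<dots> \<le> l1_norm (pCons a p) * l1_norm q"
    using pCons.IH by (simp add: l1_norm_smult l1_norm_pCons algebra_simps)
  finally show ?case .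
qed simp

text \<open>
  By comparing degrees: reducing any Bezout solution modulo \<open>G\<close> bounds the degree of \<open>g\<close>, and then
  \<open>h * G = p - g * H\<close> bounds the degree of \<open>h\<close>.
\<close>

lemma coprime_poly_solve:
  fixes G H p :: "complex poly"
  assumes "coprime G H" "degree G > 0" "degree H > 0" "degree p < degree G + degree H"
  obtains g h where "degree g < degree G" "degree h < degree H" "g * H + h * G = p"
proof -
  obtain x y where xy: "x * G + y * H = 1"
    using bezout_coefficients_fst_snd[of G H] assms(1) by (auto simp: coprime_iff_gcd_eq_1)
  define g where "g = (y * p) mod G"
  define h where "h = x * p + H * ((y * p) div G)"
  have *: "y * p = G * ((y * p) div G) + g" by (simp add: g_def)
  have "(x * G + y * H) * p = x * p * G + H * (y * p)" by (simp add: algebra_simps)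
  also have "\<dots> = g * H + h * G"
    unfolding h_def by (subst *) (simp add: algebra_simps)
  finally have "g * H + h * G = (x * G + y * H) * p" ..
  then have eq: "g * H + h * G = p" by (simp add: xy)
  have g: "degree g < degree G"
    using assms(2) degree_mod_less[of G "y * p"] by (cases "G = 0"; auto simp: g_def)
  have "degree h < degree H"
  proof (cases "h = 0")
    case False
    have "G \<noteq> 0" using assms(2) by auto
    then have "degree h + degree G = degree (h * G)" using False by (simp add: degree_mult_eq)
    also have "h * G = p - g * H" using eq by (simp add: algebra_simps)
    also have "degree (p - g * H) < degree G + degree H"
      using g assms(4) degree_mult_le[of g H] by (intro degree_diff_less) auto
    finally show ?thesis by simp
  qed (use assms in auto)
  from that[OF g this eq] show thesis .
qed

text \<open>
  Solving for the monomials below the degree \<open>degree G + degree H\<close> and extending linearly gives a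
  solution operator \<open>S\<close>; it is bounded because only finitely many monomials are involved.  The bound is
  what makes the lifted factors in \<open>hensel_convergent\<close> converge.
\<close>

lemma coprime_poly_solve_bounded:
  fixes G H :: "complex poly"
  assumes "coprime G H" "degree G > 0" "degree H > 0"
  obtains C S where "C > 0"
    "\<And>p. degree p < degree G + degree H \<Longrightarrow>
       degree (fst (S p)) < degree G \<and> degree (snd (S p)) < degree H \<and>
       fst (S p) * H + snd (S p) * G = p \<and> l1_norm (fst (S p)) + l1_norm (snd (S p)) \<le> C * l1_norm p"
proof -
  define n where "n = degree G + degree H"
  have "\<exists>g h. degree g < degree G \<and> degree h < degree H \<and> g * H + h * G = monom 1 i"
    if "i < n" for i
    by (rule coprime_poly_solve[OF assms, of "monom 1 i"]) (use that in \<open>auto simp: n_def degree_monom_eq\<close>)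
  then obtain g h where gh: "\<And>i. i < n \<Longrightarrow> degree (g i) < degree G \<and> degree (h i) < degree H \<and>
      g i * H + h i * G = monom 1 i"
    by metis
  define C where "C = 1 + (\<Sum>i<n. l1_norm (g i) + l1_norm (h i))"
  have C: "l1_norm (g i) + l1_norm (h i) \<le> C" if "i < n" for i
    using member_le_sum[of i "{..<n}" "\<lambda>i. l1_norm (g i) + l1_norm (h i)"] that by (simp add: C_def)
  define S where "S = (\<lambda>p. (\<Sum>i<n. Polynomial.smult (coeff p i) (g i), \<Sum>i<n. Polynomial.smult (coeff p i) (h i)))"
  show thesis
  proof (rule that[of C S])
    show "C > 0" by (simp add: C_def add_pos_nonneg sum_nonneg)
    fix p :: "complex poly" assume "degree p < degree G + degree H"
    then have p: "degree p < n" by (simp add: n_def)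
    then obtain m where m: "n = Suc m" "degree p \<le> m" by (cases n) auto
    have "fst (S p) * H + snd (S p) * G = (\<Sum>i<n. Polynomial.smult (coeff p i) (g i * H + h i * G))"
      by (simp add: S_def sum_distrib_right sum.distrib smult_add_right)
    also have "\<dots> = (\<Sum>i<n. monom (coeff p i) i)"
      using gh by (intro sum.cong) (auto simp: smult_monom)
    also have "\<dots> = p"
      using poly_as_sum_of_monoms'[OF m(2)] by (simp add: m(1) lessThan_Suc_atMost)
    finally have 1: "fst (S p) * H + snd (S p) * G = p" .
    have "l1_norm (fst (S p)) + l1_norm (snd (S p))
        \<le> (\<Sum>i<n. l1_norm (Polynomial.smult (coeff p i) (g i))) + (\<Sum>i<n. l1_norm (Polynomial.smult (coeff p i) (h i)))"
      unfolding S_def fst_conv snd_conv by (intro add_mono l1_norm_sum)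
    also have "\<dots> = (\<Sum>i<n. norm (coeff p i) * (l1_norm (g i) + l1_norm (h i)))"
      by (simp add: l1_norm_smult sum.distrib distrib_left)
    also have "\<dots> \<le> (\<Sum>i<n. norm (coeff p i) * C)"
      using C by (intro sum_mono mult_left_mono) auto
    also have "\<dots> = C * l1_norm p"
      using l1_norm_eq_sum[OF m(2)] by (simp add: m(1) lessThan_Suc_atMost sum_distrib_left mult.commute)
    finally have 2: "l1_norm (fst (S p)) + l1_norm (snd (S p)) \<le> C * l1_norm p" .
    have "degree (fst (S p)) < degree G"
      unfolding S_def fst_conv using gh assms
      by (intro degree_sum_less) (auto intro: le_less_trans[OF degree_smult_le])
    moreover have "degree (snd (S p)) < degree H"
      unfolding S_def snd_conv using gh assms
      by (intro degree_sum_less) (auto intro: le_less_trans[OF degree_smult_le])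
    ultimately show "degree (fst (S p)) < degree G \<and> degree (snd (S p)) < degree H \<and>
       fst (S p) * H + snd (S p) * G = p \<and> l1_norm (fst (S p)) + l1_norm (snd (S p)) \<le> C * l1_norm p"
      using 1 2 by blast
  qed
qed

text \<open>
  The coefficients of two power series \<open>g\<close>, \<open>h\<close> with constant terms \<open>I\<close> whose product is the series
  with coefficients \<open>p\<close>: in degree \<open>k + 1\<close> the two new coefficients enter linearly, through
  \<open>g\<^sub>0\<close> and \<open>h\<^sub>0\<close>, and \<open>S\<close> is a solution operator for this linear equation.
\<close>

fun hensel_seq :: "('a \<Rightarrow> 'a \<times> 'a) \<Rightarrow> 'a \<times> 'a \<Rightarrow> (nat \<Rightarrow> 'a) \<Rightarrow> nat \<Rightarrow> 'a::comm_ring \<times> 'a" where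
  "hensel_seq S I p 0 = I"
| "hensel_seq S I p (Suc k) =
     S (p (Suc k) - (\<Sum>i\<in>{1..k}. fst (hensel_seq S I p i) * snd (hensel_seq S I p (Suc k - i))))"

text \<open>
  The majorant argument.  For a small radius \<open>y\<close>, the partial sums \<open>T n\<close> of the series of \<open>a\<close> satisfy
  \<open>T (n + 1) \<le> e + C * (T n)\<^sup>2\<close>, because every product on the right of the recursion occurs in the square
  of \<open>T n\<close>.  With \<open>e = 1 / (4 * C)\<close> this keeps them below the fixed point \<open>2 * e\<close>, so that the series,
  having nonnegative terms, converges.
\<close>

lemma quadratic_majorant_summable:
  fixes a b :: "nat \<Rightarrow> real"
  assumes "\<And>k. a k \<ge> 0" "\<And>k. b k \<ge> 0" "C > 0" "x > 0" "summable (\<lambda>k. b k * x ^ k)"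
    and rec: "\<And>k. a (Suc k) \<le> C * (b (Suc k) + (\<Sum>i\<in>{1..k}. a i * a (Suc k - i)))"
  obtains y where "y > 0" "summable (\<lambda>k. a k * y ^ k)"
proof -
  define B where "B = 1 + (\<Sum>k. b k * x ^ k)"
  have bsum: "(\<Sum>k\<in>K. b k * x ^ k) \<le> B" if "finite K" for K
    using sum_le_suminf[OF assms(5), of K] that assms(2,4) by (auto simp: B_def)
  have B: "B > 0" using bsum[of "{}"] suminf_nonneg[OF assms(5)] assms(2,4) by (simp add: B_def)
  define e where "e = 1 / (4 * C)"
  have e: "e > 0" using assms(3) by (simp add: e_def)
  \<comment> \<open>Small enough to make the part of the series of \<open>b\<close> without its constant term at most \<open>e / C\<close>.\<close>
  define y where "y = x * min 1 (e / (C * B))"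
  have y: "y > 0" using assms(3,4) e B by (simp add: y_def)
  define T where "T = (\<lambda>n. \<Sum>k\<in>{1..n}. a k * y ^ k)"
  have b: "C * (\<Sum>k\<in>{1..n}. b k * y ^ k) \<le> e" for n
  proof -
    have "b k * y ^ k \<le> b k * x ^ k * (e / (C * B))" if "k \<in> {1..n}" for k
    proof -
      let ?m = "min 1 (e / (C * B))"
      have "?m ^ k \<le> ?m ^ 1"
        using that e assms(3) B by (intro power_decreasing) auto
      then have "?m ^ k \<le> e / (C * B)" by simp
      then have "b k * x ^ k * ?m ^ k \<le> b k * x ^ k * (e / (C * B))"
        using assms(2,4) by (intro mult_left_mono) auto
      then show ?thesis by (simp only: y_def power_mult_distrib mult.assoc)
    qed
    then have "(\<Sum>k\<in>{1..n}. b k * y ^ k) \<le> (\<Sum>k\<in>{1..n}. b k * x ^ k * (e / (C * B)))"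
      by (rule sum_mono)
    also have "\<dots> \<le> B * (e / (C * B))"
      unfolding sum_distrib_right[symmetric] using e assms(3) B by (intro mult_right_mono bsum) auto
    finally show ?thesis using assms(3) B by (simp add: field_simps)
  qed
  have T: "T n \<le> 2 * e" for n
  proof (induction n)
    case 0
    show ?case using e by (simp add: T_def)
  next
    case (Suc n)
    have T0: "0 \<le> T n" unfolding T_def using assms(1) y by (intro sum_nonneg) auto
    have *: "{1..Suc n} = Suc ` {0..n}" by (metis One_nat_def image_Suc_atLeastAtMost)
    \<comment> \<open>The products \<open>a i * a j\<close> on the right are indexed by the pairs \<open>(k, i)\<close>, where \<open>i + j = k + 1\<close>.\<close>
    define Q where "Q = (SIGMA k:{0..n}. {1..k})"
    have "T (Suc n) = (\<Sum>k\<in>{0..n}. a (Suc k) * y ^ Suc k)"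
      unfolding T_def * by (subst sum.reindex) auto
    also have "\<dots> \<le> (\<Sum>k\<in>{0..n}. C * (b (Suc k) + (\<Sum>i\<in>{1..k}. a i * a (Suc k - i))) * y ^ Suc k)"
      using rec y by (intro sum_mono mult_right_mono) auto
    also have "\<dots> = C * (\<Sum>k\<in>{0..n}. b (Suc k) * y ^ Suc k)
        + C * (\<Sum>k\<in>{0..n}. (\<Sum>i\<in>{1..k}. a i * a (Suc k - i)) * y ^ Suc k)"
      by (simp only: sum_distrib_left[of C _ "{0..n}"] sum.distrib[symmetric] distrib_left distrib_right mult.assoc)
    also have "(\<Sum>k\<in>{0..n}. b (Suc k) * y ^ Suc k) = (\<Sum>k\<in>{1..Suc n}. b k * y ^ k)"
      unfolding * by (subst sum.reindex) auto
    also have "(\<Sum>k\<in>{0..n}. (\<Sum>i\<in>{1..k}. a i * a (Suc k - i)) * y ^ Suc k)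
        = (\<Sum>(k, i)\<in>Q. (a i * y ^ i) * (a (Suc k - i) * y ^ (Suc k - i)))"
    proof -
      have "(\<Sum>i\<in>{1..k}. a i * a (Suc k - i)) * y ^ Suc k =
          (\<Sum>i\<in>{1..k}. (a i * y ^ i) * (a (Suc k - i) * y ^ (Suc k - i)))" for k
        unfolding sum_distrib_right
      proof (rule sum.cong)
        fix i assume "i \<in> {1..k}"
        then have "y ^ Suc k = y ^ i * y ^ (Suc k - i)" by (simp flip: power_add power_Suc)
        then show "a i * a (Suc k - i) * y ^ Suc k = a i * y ^ i * (a (Suc k - i) * y ^ (Suc k - i))"
          by (simp only: mult_ac)
      qed simp
      then show ?thesis by (simp only: Q_def) (rule sum.Sigma; simp)
    qed
    also have "\<dots> = (\<Sum>(i, j)\<in>(\<lambda>(k, i). (i, Suc k - i)) ` Q. (a i * y ^ i) * (a j * y ^ j))"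
      by (subst sum.reindex) (auto simp: inj_on_def Q_def case_prod_unfold)
    also have "\<dots> \<le> (\<Sum>(i, j)\<in>{1..n} \<times> {1..n}. (a i * y ^ i) * (a j * y ^ j))"
      using assms(1) y by (intro sum_mono2) (auto simp: Q_def)
    also have "\<dots> = T n * T n"
      unfolding T_def sum_product by (simp add: sum.cartesian_product)
    also have "\<dots> \<le> (2 * e) * (2 * e)"
      using T0 Suc.IH by (intro mult_mono) auto
    also have "C * ((2 * e) * (2 * e)) = e"
      using assms(3) by (simp add: e_def)
    finally show ?case using b[of "Suc n"] assms(3) by simp
  qed
  have "summable (\<lambda>k. a (Suc k) * y ^ Suc k)"
  proof (rule bounded_imp_summable)
    fix n
    have "(\<Sum>k\<le>n. a (Suc k) * y ^ Suc k) = T (Suc n)"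
    proof -
      have *: "{1..Suc n} = Suc ` {..n}" by (metis One_nat_def image_Suc_atLeastAtMost atLeast0AtMost)
      show ?thesis unfolding T_def * by (subst sum.reindex) auto
    qed
    then show "(\<Sum>k\<le>n. a (Suc k) * y ^ Suc k) \<le> 2 * e" using T by simp
  qed (use assms(1) y in auto)
  then have "summable (\<lambda>k. a k * y ^ k)" by (subst (asm) summable_Suc_iff)
  with y show thesis by (rule that)
qed

text \<open>
  A coprime factorisation of the constant term of a convergent series of polynomials lifts to a
  factorisation of the whole series, and the lifted factors converge as well.  The recursion
  \<open>hensel_seq\<close> finds the factors; by the boundedness of the solution operator, the sums of the norms of
  their coefficients satisfy the quadratic inequality of \<open>quadratic_majorant_summable\<close>.
\<close>

lemma hensel_convergent:
  fixes G H :: "complex poly" and p :: "nat \<Rightarrow> complex poly"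
  assumes "coprime G H" "degree G > 0" "degree H > 0" "p 0 = G * H"
    and deg: "\<And>k. k > 0 \<Longrightarrow> degree (p k) < degree G + degree H"
    and conv: "x > 0" "summable (\<lambda>k. l1_norm (p k) * x ^ k)"
  obtains g h y where "g 0 = G" "h 0 = H"
    "\<forall>k>0. degree (g k) < degree G" "\<forall>k>0. degree (h k) < degree H"
    "\<forall>k. p k = (\<Sum>i\<le>k. g i * h (k - i))"
    "y > 0" "summable (\<lambda>k. l1_norm (g k) * y ^ k)" "summable (\<lambda>k. l1_norm (h k) * y ^ k)"
proof -
  obtain C S where C: "C > 0" and S: "\<And>p. degree p < degree G + degree H \<Longrightarrow>
       degree (fst (S p)) < degree G \<and> degree (snd (S p)) < degree H \<and>
       fst (S p) * H + snd (S p) * G = p \<and> l1_norm (fst (S p)) + l1_norm (snd (S p)) \<le> C * l1_norm p"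
    using coprime_poly_solve_bounded[OF assms(1-3)] by metis
  define gh where "gh = hensel_seq S (G, H) p"
  define g where "g = fst \<circ> gh"
  define h where "h = snd \<circ> gh"
  have g0: "g 0 = G" and h0: "h 0 = H" by (simp_all add: g_def h_def gh_def)
  define r where "r = (\<lambda>k. p (Suc k) - (\<Sum>i\<in>{1..k}. g i * h (Suc k - i)))"
  have gh_Suc: "gh (Suc k) = S (r k)" for k
    by (simp add: gh_def g_def h_def r_def)
  have step: "degree (g (Suc k)) < degree G \<and> degree (h (Suc k)) < degree H \<and>
      g (Suc k) * H + h (Suc k) * G = r k \<and>
      l1_norm (g (Suc k)) + l1_norm (h (Suc k)) \<le> C * l1_norm (r k)" for k
  proof (induction k rule: less_induct)
    case (less k)
    have dg: "degree (g i) < degree G" "degree (h i) < degree H" if "i \<in> {1..k}" for i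
      using less[of "i - 1"] that by (cases i; auto)+
    have "degree (r k) < degree G + degree H"
      unfolding r_def
    proof (intro degree_diff_less degree_sum_less)
      fix i assume i: "i \<in> {1..k}"
      then have "Suc k - i \<in> {1..k}" by auto
      then show "degree (g i * h (Suc k - i)) < degree G + degree H"
        using dg(1)[OF i] dg(2)[of "Suc k - i"] degree_mult_le[of "g i" "h (Suc k - i)"] by linarith
    qed (use deg assms(2) in auto)
    from S[OF this] show ?case by (simp add: g_def h_def gh_Suc)
  qed
  have prod: "p k = (\<Sum>i\<le>k. g i * h (k - i))" for k
  proof (cases k)
    case (Suc j)
    have "{..Suc j} = insert 0 (insert (Suc j) {1..j})" by auto
    then have "(\<Sum>i\<le>k. g i * h (k - i)) =
        g 0 * h (Suc j) + (g (Suc j) * h 0 + (\<Sum>i\<in>{1..j}. g i * h (Suc j - i)))"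
      unfolding Suc by (subst \<open>{..Suc j} = _\<close>) simp
    also have "\<dots> = p k"
      using step[of j] by (simp add: Suc g0 h0 r_def algebra_simps)
    finally show ?thesis by simp
  qed (simp add: g0 h0 assms(4))
  define a where "a = (\<lambda>k. l1_norm (g k) + l1_norm (h k))"
  have a: "a (Suc k) \<le> C * (l1_norm (p (Suc k)) + (\<Sum>i\<in>{1..k}. a i * a (Suc k - i)))" for k
  proof -
    have "l1_norm (r k) \<le> l1_norm (p (Suc k)) + (\<Sum>i\<in>{1..k}. l1_norm (g i * h (Suc k - i)))"
      unfolding r_def by (rule order_trans[OF l1_norm_diff add_left_mono[OF l1_norm_sum]])
    also have "\<dots> \<le> l1_norm (p (Suc k)) + (\<Sum>i\<in>{1..k}. a i * a (Suc k - i))"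
      by (intro add_left_mono sum_mono order_trans[OF l1_norm_mult] mult_mono) (auto simp: a_def)
    finally have "C * l1_norm (r k) \<le> C * \<dots>" using C by (intro mult_left_mono) auto
    with step[of k] show ?thesis by (simp add: a_def)
  qed
  obtain y where y: "y > 0" "summable (\<lambda>k. a k * y ^ k)"
    by (rule quadratic_majorant_summable[of a "\<lambda>k. l1_norm (p k)" C x])
       (use a C conv in \<open>auto simp: a_def\<close>)
  show thesis
  proof (rule that[of g h y])
    show "summable (\<lambda>k. l1_norm (g k) * y ^ k)" "summable (\<lambda>k. l1_norm (h k) * y ^ k)"
      by (rule summable_comparison_test'[OF y(2)]; use y(1) in \<open>simp add: a_def\<close>)+
    have "degree (g k) < degree G \<and> degree (h k) < degree H" if "k > 0" for k
      using step[of "k - 1"] that by (cases k) simp_all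
    then show "\<forall>k>0. degree (g k) < degree G" "\<forall>k>0. degree (h k) < degree H" by simp_all
  qed (use g0 h0 prod y in auto)
qed

section \<open>Puiseux series without positive powers\<close>

lemma pcoeff_of_nat_0: "pcoeff (of_nat n) 0 = of_nat n"
  by (induction n) (simp_all add: zero_puiseux.rep_eq one_puiseux.rep_eq plus_puiseux.rep_eq)

instance puiseux :: field_char_0
proof
  show "inj (of_nat :: nat \<Rightarrow> puiseux)"
    by (rule injI) (metis of_nat_eq_iff pcoeff_of_nat_0)
qed

lemma is_puiseux_monom: "is_puiseux (\<lambda>q. if q = r then 1 else 0)"
proof -
  obtain a b :: int where ab: "b > 0" "r = of_int a / of_int b"
    using quotient_of_denom_pos quotient_of_div by (cases "quotient_of r") blast
  define m where "m = nat b"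
  have m: "m > 0" "r = of_int a / of_nat m" using ab by (simp_all add: m_def)
  have "(\<lambda>q. if q = r then 1 else 0) = laurent_coeffs m (fls_X_intpow (- a))"
  proof (rule laurent_coeffs_eqI[OF m(1)])
    fix q :: rat assume "(if q = r then 1 else 0) \<noteq> (0::complex)"
    then have "q * of_nat m = of_int a" using m by (auto split: if_splits)
    then show "q * of_nat m \<in> \<int>" by simp
  next
    fix n :: int
    have "- (of_int n / of_nat m) = r \<longleftrightarrow> (of_int (- n) :: rat) = of_int a"
      using m by (simp add: field_simps)
    also have "\<dots> \<longleftrightarrow> n = - a" by (simp only: of_int_eq_iff) auto
    finally show "(if - (of_int n / of_nat m) = r then 1 else 0) = fls_nth (fls_X_intpow (- a)) n"
      by simp
  qed
  then show ?thesis using m(1) is_puiseuxI[of m "fls_X_intpow (- a)"] by simp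
qed

lift_definition puiseux_monom :: "rat \<Rightarrow> puiseux" is "\<lambda>r q. if q = r then 1 else 0"
  by (rule is_puiseux_monom)

lemma puiseux_monom_nonzero [simp]: "puiseux_monom r \<noteq> 0"
  by transfer (auto simp: fun_eq_iff)

lemma puiseux_l_monom [simp]: "puiseux_l (puiseux_monom r) = r"
  by (rule puiseux_l_eqI) (auto simp: puiseux_monom.rep_eq)

lemma puiseux_l_1 [simp]: "puiseux_l 1 = 0"
  by (rule puiseux_l_eqI) (auto simp: one_puiseux.rep_eq)

lemma puiseux_l_inverse: "x \<noteq> 0 \<Longrightarrow> puiseux_l (inverse x) = - puiseux_l x"
  using puiseux_mult_leading(1)[of x "inverse x"] by simp

lemma puiseux_l_power: "x \<noteq> 0 \<Longrightarrow> puiseux_l (x ^ n) = of_nat n * puiseux_l x"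
  by (induction n) (simp_all add: puiseux_mult_leading algebra_simps)

definition puiseux_integral :: "puiseux \<Rightarrow> bool" where
  "puiseux_integral x \<longleftrightarrow> x = 0 \<or> puiseux_l x \<le> 0"

text \<open>
  For an integral series with denominator \<open>m\<close>, the substitution \<open>s = t\<^bsup>-1/m\<^esup>\<close> gives an ordinary power
  series in \<open>s\<close>.  Sums and products are compatible with this relation, so that polynomial identities
  can be checked on power series.
\<close>

definition represents :: "nat \<Rightarrow> complex fps \<Rightarrow> puiseux \<Rightarrow> bool" where
  "represents m A x \<longleftrightarrow> pcoeff x = laurent_coeffs m (fps_to_fls A)"

lemma represents_add: "represents m A x \<Longrightarrow> represents m B y \<Longrightarrow> represents m (A + B) (x + y)"
  by (simp add: represents_def plus_puiseux.rep_eq laurent_coeffs_add)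

lemma represents_mult:
  "m > 0 \<Longrightarrow> represents m A x \<Longrightarrow> represents m B y \<Longrightarrow> represents m (A * B) (x * y)"
  by (simp add: represents_def times_puiseux.rep_eq cauchy_prod_laurent fls_times_fps_to_fls)

lemma represents_0: "represents m 0 0"
  by (simp add: represents_def zero_puiseux.rep_eq laurent_coeffs_0)

lemma represents_1: "m > 0 \<Longrightarrow> represents m 1 1"
  by (simp add: represents_def one_puiseux.rep_eq laurent_coeffs_1)

lemma represents_sum:
  "(\<And>i. i \<in> I \<Longrightarrow> represents m (A i) (x i)) \<Longrightarrow> represents m (\<Sum>i\<in>I. A i) (\<Sum>i\<in>I. x i)"
  by (induction I rule: infinite_finite_induct) (auto intro: represents_0 represents_add)

lemma represents_unique: "represents m A x \<Longrightarrow> represents m A y \<Longrightarrow> x = y"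
  by (simp add: represents_def flip: pcoeff_inject)

lemma represents_unique':
  "m > 0 \<Longrightarrow> represents m A x \<Longrightarrow> represents m B x \<Longrightarrow> A = B"
  unfolding represents_def by (metis fps_to_fls_eq_iff laurent_coeffs_inj)

lemma represents_nth_0: "m > 0 \<Longrightarrow> represents m A x \<Longrightarrow> pcoeff x 0 = fps_nth A 0"
  by (simp add: represents_def laurent_coeffs_def)

lemma represents_exists:
  assumes "m > 0" "fps_conv_radius A > 0"
  obtains x where "represents m A x"
proof -
  have "is_puiseux (laurent_coeffs m (fps_to_fls A))"
    using assms by (intro is_puiseuxI) auto
  then show thesis
    using that[of "Abs_puiseux (laurent_coeffs m (fps_to_fls A))"]
    by (simp add: represents_def Abs_puiseux_inverse)
qed

lemma laurent_coeffs_common_finite: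
  assumes "finite S"
  obtains m where "m > 0"
    "\<And>x. x \<in> S \<Longrightarrow> \<exists>F. fls_conv_radius F > 0 \<and> pcoeff x = laurent_coeffs m F"
proof -
  from assms have "\<exists>m>0. \<forall>x\<in>S. \<exists>F. fls_conv_radius F > 0 \<and> pcoeff x = laurent_coeffs m F"
  proof induction
    case (insert x S)
    then obtain m where m: "m > 0"
      "\<And>y. y \<in> S \<Longrightarrow> \<exists>F. fls_conv_radius F > 0 \<and> pcoeff y = laurent_coeffs m F" by blast
    obtain k F where k: "k > 0" "fls_conv_radius F > 0" "pcoeff x = laurent_coeffs k F"
      using pcoeff_is_puiseux[of x] by (auto simp: is_puiseux_iff_laurent)
    have "\<exists>F. fls_conv_radius F > 0 \<and> pcoeff y = laurent_coeffs (m * k) F" if "y \<in> insert x S" for y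
    proof (cases "y = x")
      case True
      then show ?thesis
        using laurent_coeffs_compose_power[OF k(1) m(1), of F] k(3)
          fls_conv_radius_compose_power_pos[OF k(2) m(1)] by (auto simp: mult.commute)
    next
      case False
      with that m(2) obtain G where "fls_conv_radius G > 0" "pcoeff y = laurent_coeffs m G" by blast
      then show ?thesis
        using laurent_coeffs_compose_power[OF m(1) k(1), of G]
          fls_conv_radius_compose_power_pos[of G k] k(1) by auto
    qed
    then show ?case using m(1) k(1) by (intro exI[of _ "m * k"]) auto
  qed auto
  then show thesis using that by blast
qed

text \<open>
  Finitely many series have a common denominator, so the coefficients of one polynomial can all be
  regarded as power series in the same variable.
\<close>

lemma represents_common:
  assumes "finite S" "\<And>x. x \<in> S \<Longrightarrow> puiseux_integral x"
  obtains m where "m > 0" "\<And>x. x \<in> S \<Longrightarrow> \<exists>A. fps_conv_radius A > 0 \<and> represents m A x"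
proof -
  obtain m where m: "m > 0"
    "\<And>x. x \<in> S \<Longrightarrow> \<exists>F. fls_conv_radius F > 0 \<and> pcoeff x = laurent_coeffs m F"
    using laurent_coeffs_common_finite[OF assms(1)] by blast
  have "\<exists>A. fps_conv_radius A > 0 \<and> represents m A x" if x: "x \<in> S" for x
  proof -
    obtain F where F: "fls_conv_radius F > 0" "pcoeff x = laurent_coeffs m F"
      using m(2)[OF x] by blast
    have "fls_subdegree F \<ge> 0"
    proof (cases "F = 0")
      case False
      then have "x \<noteq> 0"
        using F(2) m(1) laurent_coeffs_inj[of m F 0]
        by (auto simp: zero_puiseux.rep_eq laurent_coeffs_0)
      then have "puiseux_l x \<le> 0" using assms(2)[OF x] by (simp add: puiseux_integral_def)
      then show ?thesis using puiseux_leading_laurent(1)[OF F(2) m(1) False] m(1)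
        by (simp add: zero_le_divide_iff)
    qed simp
    then have eq: "fps_to_fls (fls_regpart F) = F" by simp
    show ?thesis
    proof (intro exI conjI)
      show "represents m (fls_regpart F) x" by (simp add: represents_def eq F(2))
      show "fps_conv_radius (fls_regpart F) > 0"
        using F(1) by (metis eq fls_conv_radius_fps_to_fls)
    qed
  qed
  with m(1) show thesis by (rule that)
qed

lemma coeff_sum_monom:
  "coeff (\<Sum>j\<le>n. monom (f j) j) i = (if i \<le> n then f i else 0)"
  by (auto simp: coeff_sum if_distrib[of "\<lambda>p. coeff p i"] cong: if_cong)

lemma coeff_pcompose_scale:
  fixes c :: "'a::comm_semiring_1"
  shows "coeff (pcompose p [:0, c:]) i = coeff p i * c ^ i"
proof (induction p arbitrary: i)
  case (pCons a p)
  then show ?case by (cases i) (simp_all add: pcompose_pCons mult_ac)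
qed simp

lemma fps_conv_radius_coeff_pos:
  assumes "y > 0" "summable (\<lambda>k. l1_norm (g k) * y ^ k)"
  shows "fps_conv_radius (Abs_fps (\<lambda>k. coeff (g k) i)) > 0"
proof -
  have "summable (\<lambda>k. coeff (g k) i * of_real y ^ k)"
    by (rule summable_comparison_test'[OF assms(2), of 0])
       (use assms(1) in \<open>simp add: norm_mult norm_power norm_coeff_le_l1_norm mult_right_mono\<close>)
  then have "conv_radius (\<lambda>k. coeff (g k) i) \<ge> norm (complex_of_real y)"
    by (rule conv_radius_geI)
  then show ?thesis
    using assms(1) by (simp add: fps_conv_radius_def order_less_le_trans[of 0 "ereal y"])
qed

lemma fps_common_abs_summable:
  fixes A :: "nat \<Rightarrow> complex fps"
  assumes "\<And>j. j \<le> n \<Longrightarrow> fps_conv_radius (A j) > 0"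
  obtains x where "x > 0" "\<And>j. j \<le> n \<Longrightarrow> summable (\<lambda>k. norm (fps_nth (A j) k) * x ^ k)"
proof -
  have "\<exists>r>0. ereal r < fps_conv_radius (A j)" if "j \<le> n" for j
    using assms[OF that] by (metis ereal_dense2 ereal_less(2))
  then obtain r where r: "\<And>j. j \<le> n \<Longrightarrow> r j > 0" "\<And>j. j \<le> n \<Longrightarrow> ereal (r j) < fps_conv_radius (A j)"
    by metis
  define x where "x = Min (r ` {..n})"
  have x: "x > 0" unfolding x_def using r(1) by (subst Min_gr_iff) auto
  moreover have "summable (\<lambda>k. norm (fps_nth (A j) k) * x ^ k)" if j: "j \<le> n" for j
  proof -
    have "x \<le> r j" unfolding x_def using j by (intro Min_le) auto
    then have "ereal (norm (complex_of_real x)) < conv_radius (fps_nth (A j))"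
      using r(2)[OF j] x by (simp add: fps_conv_radius_def) (metis ereal_less_eq(3) order_le_less_trans)
    then have "summable (\<lambda>k. norm (fps_nth (A j) k * of_real x ^ k))"
      by (rule abs_summable_in_conv_radius)
    then show ?thesis using x by (simp add: norm_mult norm_power)
  qed
  ultimately show thesis by (rule that)
qed

section \<open>Algebraic closedness\<close>

text \<open>
  The image of a polynomial with integral coefficients over the residue field: integral series are
  reduced modulo those that have only negative exponents, which leaves the coefficient of \<open>t\<^sup>0\<close>.
\<close>

definition residue_poly :: "puiseux poly \<Rightarrow> complex poly" where
  "residue_poly b = map_poly (\<lambda>x. pcoeff x 0) b"

lemma coeff_residue_poly: "coeff (residue_poly b) i = pcoeff (coeff b i) 0"
  by (simp add: residue_poly_def coeff_map_poly zero_puiseux.rep_eq)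

text \<open>
  The coefficients of \<open>b\<close> are power series in one variable \<open>s\<close>.  Collecting the powers of \<open>s\<close> turns
  \<open>b\<close> into a series of complex polynomials \<open>p k\<close>, whose constant term is the residue polynomial, and
  \<open>hensel_convergent\<close> factors this series.  As \<open>b\<close> is monic, the terms \<open>p k\<close> with \<open>k > 0\<close> have smaller
  degree, as required there.
\<close>

lemma puiseux_hensel:
  assumes monic: "lead_coeff b = 1" and int: "\<And>i. puiseux_integral (coeff b i)"
    and res: "residue_poly b = G * H" and GH: "coprime G H" "degree G > 0" "degree H > 0"
  obtains g h where "b = g * h" "degree g > 0" "degree h > 0"
proof -
  define n where "n = degree b"
  have cn: "coeff b n = 1" using monic by (simp add: n_def)
  have "degree (residue_poly b) = n"
  proof (rule antisym)
    show "degree (residue_poly b) \<le> n"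
      by (rule degree_le) (simp add: coeff_residue_poly n_def coeff_eq_0 zero_puiseux.rep_eq)
    show "n \<le> degree (residue_poly b)"
      by (rule le_degree) (simp add: coeff_residue_poly cn one_puiseux.rep_eq)
  qed
  then have n: "n = degree G + degree H"
    using GH res by (metis degree_0 degree_mult_eq less_irrefl)
  obtain m where m: "m > 0"
    "\<And>x. x \<in> coeff b ` {..n} \<Longrightarrow> \<exists>A. fps_conv_radius A > 0 \<and> represents m A x"
    using represents_common[of "coeff b ` {..n}"] int by (metis finite_atMost finite_imageI imageE)
  have "\<exists>A. fps_conv_radius A > 0 \<and> represents m A (coeff b j)" for j
  proof (cases "j \<le> n")
    case False
    then show ?thesis
      using represents_0[of m] by (intro exI[of _ 0]) (simp add: n_def coeff_eq_0)
  qed (use m(2) in auto)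
  then obtain A where A: "\<And>j. fps_conv_radius (A j) > 0" "\<And>j. represents m (A j) (coeff b j)"
    by metis
  have A0: "A j = 0" if "j > n" for j
    using A(2)[of j] represents_unique'[OF m(1) _ represents_0] that by (simp add: n_def coeff_eq_0)
  have An: "A n = 1"
    using A(2)[of n] represents_unique'[OF m(1) _ represents_1[OF m(1)]] by (simp add: cn)
  define p where "p = (\<lambda>k. \<Sum>j\<le>n. monom (fps_nth (A j) k) j)"
  have coeff_p: "coeff (p k) j = fps_nth (A j) k" for k j
    by (simp add: p_def coeff_sum_monom A0 not_le)
  have p0: "p 0 = G * H"
    by (rule poly_eqI)
       (simp only: coeff_p represents_nth_0[OF m(1) A(2), symmetric] coeff_residue_poly[symmetric] res)
  have deg: "degree (p k) < degree G + degree H" if "k > 0" for k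
  proof -
    have "coeff (p k) j = 0" if "j > n - 1" for j
    proof (cases "j = n")
      case True
      then show ?thesis using \<open>k > 0\<close> by (simp add: coeff_p An)
    qed (use that A0 in \<open>simp add: coeff_p\<close>)
    then have "degree (p k) \<le> n - 1" by (intro degree_le) auto
    then show ?thesis using n GH by linarith
  qed
  obtain x where x: "x > 0" "\<And>j. j \<le> n \<Longrightarrow> summable (\<lambda>k. norm (fps_nth (A j) k) * x ^ k)"
    using fps_common_abs_summable[of n A] A(1) by metis
  have "l1_norm (p k) = (\<Sum>j\<le>n. norm (fps_nth (A j) k))" for k
    by (subst l1_norm_eq_sum[of _ n]) (auto intro!: degree_le simp: coeff_p A0)
  then have conv: "summable (\<lambda>k. l1_norm (p k) * x ^ k)"
    using x(2) by (auto simp: sum_distrib_right intro!: summable_sum)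
  obtain g h y where gh: "g 0 = G" "h 0 = H"
    "\<forall>k>0. degree (g k) < degree G" "\<forall>k>0. degree (h k) < degree H"
    "\<forall>k. p k = (\<Sum>i\<le>k. g i * h (k - i))"
    and y: "y > 0" "summable (\<lambda>k. l1_norm (g k) * y ^ k)" "summable (\<lambda>k. l1_norm (h k) * y ^ k)"
    by (rule hensel_convergent[OF GH p0 deg x(1) conv], assumption) (rule that)
  define Gf where "Gf = (\<lambda>i. Abs_fps (\<lambda>k. coeff (g k) i))"
  define Hf where "Hf = (\<lambda>i. Abs_fps (\<lambda>k. coeff (h k) i))"
  have "\<exists>u. represents m (Gf i) u" "\<exists>u. represents m (Hf i) u" for i
    unfolding Gf_def Hf_def
    using represents_exists[OF m(1) fps_conv_radius_coeff_pos[OF y(1,2)]]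
      represents_exists[OF m(1) fps_conv_radius_coeff_pos[OF y(1,3)]] by metis+
  then obtain u v where u: "\<And>i. represents m (Gf i) (u i)" and v: "\<And>i. represents m (Hf i) (v i)"
    by metis
  have "Gf i = 0" if "i > degree G" for i
  proof (rule fps_ext)
    fix k show "fps_nth (Gf i) k = fps_nth 0 k"
      using that gh(1,3) by (cases "k = 0") (auto simp: Gf_def intro!: coeff_eq_0 intro: less_trans)
  qed
  then have u0: "u i = 0" if "i > degree G" for i
    using that u[of i] represents_unique[OF _ represents_0] by metis
  have "Hf i = 0" if "i > degree H" for i
  proof (rule fps_ext)
    fix k show "fps_nth (Hf i) k = fps_nth 0 k"
      using that gh(2,4) by (cases "k = 0") (auto simp: Hf_def intro!: coeff_eq_0 intro: less_trans)
  qed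
  then have v0: "v i = 0" if "i > degree H" for i
    using that v[of i] represents_unique[OF _ represents_0] by metis
  define gg where "gg = (\<Sum>i\<le>degree G. monom (u i) i)"
  define hh where "hh = (\<Sum>i\<le>degree H. monom (v i) i)"
  have coeff_gg: "coeff gg i = u i" for i by (simp add: gg_def coeff_sum_monom u0 not_le)
  have coeff_hh: "coeff hh i = v i" for i by (simp add: hh_def coeff_sum_monom v0 not_le)
  show thesis
  proof (rule that)
    show "b = gg * hh"
    proof (rule poly_eqI)
      fix j
      have "represents m (\<Sum>i\<le>j. Gf i * Hf (j - i)) (coeff (gg * hh) j)"
        unfolding coeff_mult coeff_gg coeff_hh
        by (intro represents_sum represents_mult u v m(1))
      also have "(\<Sum>i\<le>j. Gf i * Hf (j - i)) = A j"
      proof (rule fps_ext)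
        fix k
        have "fps_nth (\<Sum>i\<le>j. Gf i * Hf (j - i)) k =
            (\<Sum>i\<le>j. \<Sum>l\<le>k. coeff (g l) i * coeff (h (k - l)) (j - i))"
          by (simp add: fps_sum_nth fps_mult_nth Gf_def Hf_def atLeast0AtMost)
        also have "\<dots> = (\<Sum>l\<le>k. \<Sum>i\<le>j. coeff (g l) i * coeff (h (k - l)) (j - i))"
          by (rule sum.swap)
        also have "\<dots> = coeff (p k) j"
          using gh(5) by (simp add: coeff_sum coeff_mult)
        finally show "fps_nth (\<Sum>i\<le>j. Gf i * Hf (j - i)) k = fps_nth (A j) k"
          by (simp add: coeff_p)
      qed
      finally show "coeff b j = coeff (gg * hh) j"
        using A(2) represents_unique by blast
    qed
    have "pcoeff (u (degree G)) 0 \<noteq> 0"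
      using represents_nth_0[OF m(1) u] GH(2) by (auto simp: Gf_def gh(1))
    then have "coeff gg (degree G) \<noteq> 0" by (auto simp: coeff_gg zero_puiseux.rep_eq)
    then show "degree gg > 0" using le_degree[of gg] GH(2) by fastforce
    have "pcoeff (v (degree H)) 0 \<noteq> 0"
      using represents_nth_0[OF m(1) v] GH(3) by (auto simp: Hf_def gh(2))
    then have "coeff hh (degree H) \<noteq> 0" by (auto simp: coeff_hh zero_puiseux.rep_eq)
    then show "degree hh > 0" using le_degree[of hh] GH(3) by fastforce
  qed
qed

text \<open>
  If \<open>x\<close> were the only root, \<open>P\<close> would be a multiple of \<open>(u - x)\<^sup>n\<close>.  The coefficient of \<open>u\<^bsup>n-1\<^esup>\<close> would
  be proportional to \<open>n * x\<close>, so \<open>x\<close> would vanish and \<open>P\<close> would be a monomial.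
\<close>

lemma depressed_poly_two_roots:
  fixes P :: "complex poly"
  assumes "degree P > 1" "coeff P (degree P - 1) = 0" "k < degree P" "coeff P k \<noteq> 0"
  obtains x y where "poly P x = 0" "poly P y = 0" "x \<noteq> y"
proof -
  have P0: "P \<noteq> 0" using assms(1) by auto
  obtain M where M: "size M = degree P" "P = Polynomial.smult (lead_coeff P) (\<Prod>x\<in>#M. [:- x, 1:])"
    using alg_closed_imp_factorization[OF P0] by blast
  have roots: "poly P z = 0" if "z \<in># M" for z
  proof -
    have "poly (\<Prod>x\<in>#M. [:- x, 1:]) z = 0"
      using that by (auto simp: poly_prod_mset prod_mset_zero_iff)
    then show ?thesis by (subst M(2)) simp
  qed
  obtain x where x: "x \<in># M" using M(1) assms(1) by fastforce
  have "\<exists>y. y \<in># M \<and> y \<noteq> x"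
  proof (rule ccontr)
    assume "\<not> ?thesis"
    then have "M = replicate_mset (degree P) x"
      using M(1) set_mset_subset_singletonD[of M x] by auto
    then have P: "P = Polynomial.smult (lead_coeff P) ([:- x, 1:] ^ degree P)"
      using M(2) by (simp add: image_replicate_mset)
    have c: "coeff P i = lead_coeff P * (of_nat (degree P choose i) * (- x) ^ (degree P - i))"
      if "i \<le> degree P" for i
      using that by (subst P) (simp add: coeff_linear_poly_power)
    have "degree P choose (degree P - 1) = degree P"
      using assms(1) by (subst binomial_symmetric) auto
    then have "x = 0" using c[of "degree P - 1"] assms(1,2) P0 by auto
    then show False using c[of k] assms(3,4) by (simp add: power_0_left)
  qed
  then show thesis using that x roots by blast
qed

text \<open>
  The Newton--Puiseux theorem.  It suffices to factor a monic polynomial \<open>p\<close> of degree \<open>n > 1\<close> whose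
  coefficient of degree \<open>n - 1\<close> vanishes.  The substitution \<open>u \<mapsto> t\<^sup>r u\<close>, where \<open>r\<close> is the largest of
  the slopes \<open>s k\<close>, makes all coefficients integral, and a coefficient below the leading one, which
  attains the maximum, keeps a nonzero residue.  So the residue polynomial has two different roots,
  hence two coprime factors of positive degree, and these lift by \<open>puiseux_hensel\<close>.
\<close>

instance puiseux :: alg_closed_field
proof (rule alg_closedI_reducible_coeff_deg_minus_one_eq_0)
  fix p :: "puiseux poly"
  assume p: "degree p > 1" "lead_coeff p = 1" "coeff p (degree p - 1) = 0" "coeff p 0 \<noteq> 0"
  define n where "n = degree p"
  define s where "s = (\<lambda>k. puiseux_l (coeff p k) / (of_nat n - of_nat k))"
  define K where "K = {k. k < n \<and> coeff p k \<noteq> 0}"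
  have "0 \<in> K" using p(1,4) by (simp add: K_def n_def)
  then have K: "finite K" "K \<noteq> {}" by (auto simp: K_def)
  define r where "r = Max (s ` K)"
  have "r \<in> s ` K" unfolding r_def using K by (intro Max_in) auto
  then obtain k0 where k0: "k0 \<in> K" "s k0 = r" by auto
  have sr: "s k \<le> r" if "k \<in> K" for k using that K by (auto simp: r_def)
  define t where "t = puiseux_monom r"
  have t: "t \<noteq> 0" "puiseux_l t = r" by (simp_all add: t_def)
  define b where "b = Polynomial.smult (inverse (t ^ n)) (pcompose p [:0, t:])"
  have cb: "coeff b k = inverse (t ^ n) * (coeff p k * t ^ k)" for k
    by (simp add: b_def coeff_pcompose_scale)
  have deg_b: "degree b = n"
    using t(1) by (simp add: b_def n_def degree_pcompose)
  have cbn: "coeff b n = 1" using t(1) p(2) by (simp add: cb n_def)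
  have lb: "puiseux_l (coeff b k) = (s k - r) * (of_nat n - of_nat k)" if "k \<in> K" for k
  proof -
    have k: "k < n" "coeff p k \<noteq> 0" using that by (auto simp: K_def)
    have "puiseux_l (coeff b k) = - (of_nat n * r) + (puiseux_l (coeff p k) + of_nat k * r)"
      unfolding cb using k t by (simp add: puiseux_mult_leading puiseux_l_inverse puiseux_l_power)
    moreover have "puiseux_l (coeff p k) = s k * (of_nat n - of_nat k)"
      using k by (simp add: s_def)
    ultimately show ?thesis by (simp add: algebra_simps)
  qed
  have int: "puiseux_integral (coeff b k)" for k
  proof (cases "k \<in> K")
    case True
    then have "of_nat k \<le> (of_nat n :: rat)" by (simp add: K_def)
    then have "puiseux_l (coeff b k) \<le> 0"
      unfolding lb[OF True] using sr[OF True] by (intro mult_nonpos_nonneg) auto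
    then show ?thesis by (simp add: puiseux_integral_def)
  next
    case False
    show ?thesis
    proof (cases "k = n")
      case True
      then show ?thesis by (simp add: puiseux_integral_def cbn)
    next
      case False
      with \<open>k \<notin> K\<close> have "coeff p k = 0" by (cases "k < n") (auto simp: K_def n_def coeff_eq_0)
      then show ?thesis by (simp add: puiseux_integral_def cb)
    qed
  qed
  define P where "P = residue_poly b"
  have cPn: "coeff P n = 1" by (simp add: P_def coeff_residue_poly cbn one_puiseux.rep_eq)
  have deg_P: "degree P = n"
  proof (rule antisym)
    show "degree P \<le> n"
      by (rule degree_le) (simp add: P_def coeff_residue_poly flip: deg_b, simp add: coeff_eq_0 zero_puiseux.rep_eq)
    show "n \<le> degree P" by (rule le_degree) (simp add: cPn)
  qed
  have cP1: "coeff P (degree P - 1) = 0"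
    using p(3) unfolding deg_P by (simp add: P_def coeff_residue_poly cb n_def zero_puiseux.rep_eq)
  have "coeff b k0 \<noteq> 0" "puiseux_l (coeff b k0) = 0"
    using k0 lb[of k0] t(1) by (auto simp: cb K_def)
  then have cPk: "coeff P k0 \<noteq> 0"
    using puiseux_l_greatest(1)[of "coeff b k0"] by (simp add: P_def coeff_residue_poly puiseux_lc_def)
  have "degree P > 1" "k0 < degree P" using p(1) k0(1) by (auto simp: deg_P n_def K_def)
  then obtain x y where "poly P x = 0" "poly P y = 0" "x \<noteq> y"
    using depressed_poly_two_roots[OF _ cP1 _ cPk] by blast
  with \<open>degree P > 1\<close> obtain G H where GH: "degree G > 0" "degree H > 0" "coprime G H" "P = G * H"
    using alg_closed_imp_poly_splits_coprime by blast
  have "lead_coeff b = 1" by (simp add: deg_b cbn)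
  then obtain g h where gh: "b = g * h" "degree g > 0" "degree h > 0"
    using puiseux_hensel[OF _ int _ GH(3,1,2)] GH(4) by (metis P_def)
  have "p = Polynomial.smult (t ^ n) (pcompose b [:0, inverse t:])"
    using t(1) by (intro poly_eqI) (simp add: coeff_pcompose_scale cb field_simps)
  also have "\<dots> = Polynomial.smult (t ^ n) (pcompose g [:0, inverse t:]) * pcompose h [:0, inverse t:]"
    by (simp add: gh(1) pcompose_mult)
  finally show "\<not> irreducible p"
    by (rule reducible_polyI) (use gh t(1) in \<open>simp_all add: degree_pcompose\<close>)
qed

section \<open>The ordered subfield of real series\<close>

lemma zero_less_puiseux_iff: "0 < x \<longleftrightarrow> puiseux_pos x"
  by (simp add: less_puiseux_def)

lemma real_puiseux_iff_conjugate: "x \<in> real_puiseux \<longleftrightarrow> conjugate x = x"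
  by (auto simp: real_puiseux_def Reals_cnj_iff conjugate_puiseux.rep_eq fun_eq_iff simp flip: pcoeff_inject)

lemma conjugate_puiseux_1 [simp]: "conjugate (1 :: puiseux) = 1"
  by transfer auto

lemma real_puiseux_add: "x \<in> real_puiseux \<Longrightarrow> y \<in> real_puiseux \<Longrightarrow> x + y \<in> real_puiseux"
  and real_puiseux_mult: "x \<in> real_puiseux \<Longrightarrow> y \<in> real_puiseux \<Longrightarrow> x * y \<in> real_puiseux"
  and real_puiseux_uminus: "x \<in> real_puiseux \<Longrightarrow> - x \<in> real_puiseux"
  by (simp_all add: real_puiseux_iff_conjugate conjugate_dist_add conjugate_dist_mul conjugate_neg)

lemma real_puiseux_diff: "x \<in> real_puiseux \<Longrightarrow> y \<in> real_puiseux \<Longrightarrow> x - y \<in> real_puiseux"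
  using real_puiseux_add[OF _ real_puiseux_uminus, of x y] by simp

lemma real_puiseux_inverse: 
  assumes "x \<in> real_puiseux"
  shows "inverse x \<in> real_puiseux"
proof (cases "x = 0")
  case False
  have "conjugate (inverse x) * conjugate x = 1"
    using False by (simp flip: conjugate_dist_mul)
  then have "conjugate (inverse x) = inverse x"
    using assms False by (simp add: real_puiseux_iff_conjugate field_simps)
  then show ?thesis by (simp add: real_puiseux_iff_conjugate)
qed (use assms in simp)

lemma puiseux_lc_real: "x \<in> real_puiseux \<Longrightarrow> puiseux_lc x = of_real (Re (puiseux_lc x))"
  by (simp add: real_puiseux_def puiseux_lc_def)

lemma puiseux_pos_real: "puiseux_pos x \<Longrightarrow> x \<in> real_puiseux"
  and puiseux_pos_nonzero: "puiseux_pos x \<Longrightarrow> x \<noteq> 0"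
  by (simp_all add: puiseux_pos_def)

lemma puiseux_lc_1 [simp]: "puiseux_lc 1 = 1"
  by (simp add: puiseux_lc_def one_puiseux.rep_eq)

lemma puiseux_pos_1 [simp]: "puiseux_pos 1"
  by (simp add: puiseux_pos_def real_puiseux_iff_conjugate)

lemma puiseux_pos_mult:
  assumes "puiseux_pos x" "puiseux_pos y"
  shows "puiseux_pos (x * y)"
proof -
  have "puiseux_lc (x * y) = of_real (Re (puiseux_lc x)) * of_real (Re (puiseux_lc y))"
    using assms puiseux_lc_real by (simp add: puiseux_pos_def puiseux_mult_leading)
  then have "Re (puiseux_lc (x * y)) = Re (puiseux_lc x) * Re (puiseux_lc y)" by simp
  then show ?thesis using assms by (simp add: puiseux_pos_def real_puiseux_mult)
qed

lemma puiseux_pos_inverse: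
  assumes "puiseux_pos x"
  shows "puiseux_pos (inverse x)"
proof -
  have x: "x \<noteq> 0" "x \<in> real_puiseux" "Re (puiseux_lc x) > 0"
    using assms by (simp_all add: puiseux_pos_def)
  have "1 = puiseux_lc (x * inverse x)" using x(1) by simp
  also have "\<dots> = of_real (Re (puiseux_lc x)) * puiseux_lc (inverse x)"
    using x puiseux_lc_real[OF x(2)] by (simp only: puiseux_mult_leading(2) inverse_nonzero_iff_nonzero not_False_eq_True)
  finally have "Re (puiseux_lc x) * Re (puiseux_lc (inverse x)) = 1"
    by (simp add: complex_eq_iff)
  then have "Re (puiseux_lc (inverse x)) > 0"
    using x(3) zero_less_mult_pos[of "Re (puiseux_lc x)" "Re (puiseux_lc (inverse x))"] by simp
  then show ?thesis using x real_puiseux_inverse by (simp add: puiseux_pos_def)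
qed

lemma real_puiseux_trichotomy:
  assumes "x \<in> real_puiseux" "x \<noteq> 0"
  shows "puiseux_pos x \<or> puiseux_pos (- x)"
proof -
  have "puiseux_lc x \<noteq> 0" using assms(2) by (rule puiseux_l_greatest)
  then have "Re (puiseux_lc x) \<noteq> 0" using puiseux_lc_real[OF assms(1)] by auto
  then show ?thesis
    using assms by (auto simp: puiseux_pos_def puiseux_lc_uminus real_puiseux_uminus)
qed

lemma puiseux_pos_linear:
  assumes "puiseux_pos x" "puiseux_pos y"
  shows "x \<le> y \<or> y \<le> x"
  using real_puiseux_trichotomy[of "y - x"] assms puiseux_pos_real real_puiseux_diff
  by (auto simp: less_eq_puiseux_def)

text \<open>
  Leading coefficients of positive series are positive reals, so that they cannot cancel.
\<close>

lemma puiseux_l_add_pos: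
  assumes "puiseux_pos x" "puiseux_pos y"
  shows "puiseux_l (x + y) = max (puiseux_l x) (puiseux_l y)"
proof -
  have x: "x \<noteq> 0" "Re (puiseux_lc x) > 0" and y: "y \<noteq> 0" "Re (puiseux_lc y) > 0"
    using assms by (auto simp: puiseux_pos_def)
  define q where "q = max (puiseux_l x) (puiseux_l y)"
  have re: "Re (pcoeff (x + y) q) > 0"
    using x(2) y(2) puiseux_l_greatest(2)[OF x(1)] puiseux_l_greatest(2)[OF y(1)]
    unfolding q_def puiseux_lc_def plus_puiseux.rep_eq
    by (cases "puiseux_l x" "puiseux_l y" rule: linorder_cases) auto
  have "puiseux_l (x + y) = q"
  proof (rule puiseux_l_eqI)
    show "pcoeff (x + y) q \<noteq> 0" using re by auto
    show "pcoeff (x + y) p = 0" if "p > q" for p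
      using that puiseux_l_greatest(2)[OF x(1), of p] puiseux_l_greatest(2)[OF y(1), of p]
      by (simp add: q_def plus_puiseux.rep_eq)
  qed
  then show ?thesis by (simp add: q_def)
qed

lemma puiseux_l_mono:
  assumes "puiseux_pos x" "x \<le> y"
  shows "puiseux_l x \<le> puiseux_l y"
  using puiseux_l_add_pos[OF assms(1), of "y - x"] assms(2) by (auto simp: less_eq_puiseux_def)

text \<open>
  A square root \<open>y\<close> exists by algebraic closedness.  Its conjugate has the same square, so it is \<open>y\<close>
  or \<open>- y\<close>.  In the second case the leading coefficient of \<open>y\<close> would be imaginary and that of \<open>x\<close>
  negative.  So \<open>y\<close> is real, and one of \<open>y\<close>, \<open>- y\<close> is positive.
\<close>

lemma puiseux_sqrt_exists:
  assumes "puiseux_pos x"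
  obtains y where "puiseux_pos y" "y\<^sup>2 = x"
proof -
  obtain y where y: "y\<^sup>2 = x" using nth_root_exists[of 2 x] by auto
  have nz: "y \<noteq> 0" using y puiseux_pos_nonzero[OF assms] by auto
  have "(conjugate y)\<^sup>2 = y\<^sup>2"
    using puiseux_pos_real[OF assms] unfolding y
    by (metis conjugate_dist_mul power2_eq_square real_puiseux_iff_conjugate y)
  then consider "conjugate y = y" | "conjugate y = - y" by (auto simp: power2_eq_iff)
  then have "y \<in> real_puiseux"
  proof cases
    case 2
    have "puiseux_lc (conjugate y) = cnj (puiseux_lc y)"
      by (simp add: puiseux_lc_def puiseux_l_def conjugate_puiseux.rep_eq)
    then have "cnj (puiseux_lc y) = - puiseux_lc y" by (simp add: 2 puiseux_lc_uminus)
    then have "Re (puiseux_lc y) = 0" by (simp add: complex_eq_iff)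
    moreover have "puiseux_lc x = puiseux_lc y * puiseux_lc y"
      using puiseux_mult_leading(2)[OF nz nz] y by (simp add: power2_eq_square)
    ultimately have "Re (puiseux_lc x) \<le> 0" by simp
    with assms show ?thesis by (simp add: puiseux_pos_def)
  qed (simp add: real_puiseux_iff_conjugate)
  from real_puiseux_trichotomy[OF this nz] show thesis
    using that[of y] that[of "- y"] y by auto
qed

lemma puiseux_square_mono:
  assumes "puiseux_pos x" "x \<le> y"
  shows "x\<^sup>2 \<le> y\<^sup>2"
proof (cases "x = y")
  case False
  then have d: "puiseux_pos (y - x)" using assms(2) by (simp add: less_eq_puiseux_def)
  have "puiseux_pos y" using puiseux_pos_add[OF assms(1) d] by simp
  then have "puiseux_pos ((y - x) * (y + x))"
    using d assms(1) by (intro puiseux_pos_mult puiseux_pos_add)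
  then show ?thesis by (simp add: less_eq_puiseux_def power2_eq_square algebra_simps)
qed simp

lemma puiseux_square_inj:
  assumes "puiseux_pos x" "puiseux_pos y" "x\<^sup>2 = y\<^sup>2"
  shows "x = y"
  using assms not_puiseux_pos_uminus by (auto simp: power2_eq_iff)

lemma sorted_wrt_ge_unique:
  fixes xs ys :: "'a::order list"
  assumes "sorted_wrt (\<ge>) xs" "sorted_wrt (\<ge>) ys" "mset xs = mset ys"
  shows "xs = ys"
  using assms
proof (induction xs arbitrary: ys)
  case (Cons x xs)
  then obtain y ys' where ys: "ys = y # ys'" by (cases ys) auto
  have "x \<in> set ys" "y \<in> set (x # xs)"
    using Cons.prems(3) unfolding ys by (metis list.set_intros(1) set_mset_mset)+
  then have "y \<le> x" "x \<le> y" using Cons.prems(1,2) by (auto simp: ys)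
  then have "x = y" by simp
  then show ?case using Cons by (simp add: ys)
qed simp

text \<open>
  The order is total on the positive series, but not on the whole type, so the sorted list is built
  by inserting one element at a time.
\<close>

lemma puiseux_pos_sorted_list_exists:
  "(\<And>x. x \<in># M \<Longrightarrow> puiseux_pos x) \<Longrightarrow> \<exists>xs. sorted_wrt (\<ge>) xs \<and> mset xs = M"
proof (induction M)
  case (add a M)
  then obtain xs where xs: "sorted_wrt (\<ge>) xs" "mset xs = M" by auto
  define ys where "ys = filter (\<lambda>x. x \<ge> a) xs @ a # filter (\<lambda>x. \<not> x \<ge> a) xs"
  have le: "x \<le> a" if "x \<in> set xs" "\<not> a \<le> x" for x
    using that puiseux_pos_linear[of a x] add.prems xs(2) by auto
  have "sorted_wrt (\<ge>) ys"
    unfolding ys_def sorted_wrt_append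
    using xs(1) le by (auto simp: sorted_wrt_filter intro: order_trans)
  moreover have "mset ys = add_mset a M"
    by (simp add: ys_def xs(2)[symmetric] flip: multiset_partition)
  ultimately show ?case by blast
qed auto

text \<open>
  The list in the definition of \<open>decreasing_sqrt_roots\<close> exists and is unique because squaring is a
  strictly increasing bijection of the positive series.  It consists of the square roots of the sorted
  roots, and taking a square root halves the leading exponent.
\<close>

lemma decreasing_sqrt_roots_squares:
  assumes "\<And>r. r \<in># proots p \<Longrightarrow> puiseux_pos r"
  obtains rs where "sorted_wrt (\<ge>) rs" "mset rs = proots p"
    "map puiseux_l (decreasing_sqrt_roots p) = map (\<lambda>r. 1 / 2 * puiseux_l r) rs"
proof -
  obtain rs where rs: "sorted_wrt (\<ge>) rs" "mset rs = proots p"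
    using puiseux_pos_sorted_list_exists assms by metis
  have pos: "puiseux_pos r" if "r \<in> set rs" for r
    using that assms rs(2) by (metis set_mset_mset)
  have "\<exists>y. puiseux_pos y \<and> y\<^sup>2 = r" if "puiseux_pos r" for r
    using puiseux_sqrt_exists[OF that] by blast
  then obtain sq where sq: "\<And>r. puiseux_pos r \<Longrightarrow> puiseux_pos (sq r) \<and> (sq r)\<^sup>2 = r"
    by metis
  define ts where "ts = map sq rs"
  have ts: "\<forall>a\<in>set ts. a > 0" "map (\<lambda>a. a\<^sup>2) ts = rs"
    using sq pos by (auto simp: ts_def zero_less_puiseux_iff o_def intro!: map_idI)
  have mono: "sq r \<le> sq r'" if r: "puiseux_pos r" "puiseux_pos r'" "r \<le> r'" for r r'
  proof (rule ccontr)
    assume *: "\<not> sq r \<le> sq r'"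
    then have le: "sq r' \<le> sq r" using puiseux_pos_linear[of "sq r" "sq r'"] sq r by blast
    then have "r' \<le> r" using puiseux_square_mono[of "sq r'" "sq r"] sq r by metis
    then have "r = r'" using r(3) by simp
    with * show False by simp
  qed
  have sorted: "sorted_wrt (\<ge>) ts"
    unfolding ts_def sorted_wrt_map
    by (rule sorted_wrt_mono_rel[OF _ rs(1)]) (use pos mono in auto)
  have "decreasing_sqrt_roots p = ts"
    unfolding decreasing_sqrt_roots_def
  proof (rule the_equality)
    show "(\<forall>a\<in>set ts. a > 0) \<and> sorted_wrt (\<ge>) ts \<and> mset (map (\<lambda>a. a\<^sup>2) ts) = proots p"
      using ts sorted rs(2) by simp
    fix bs assume bs: "(\<forall>a\<in>set bs. a > 0) \<and> sorted_wrt (\<ge>) bs \<and> mset (map (\<lambda>a. a\<^sup>2) bs) = proots p"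
    have "sorted_wrt (\<ge>) (map (\<lambda>a. a\<^sup>2) bs)"
      unfolding sorted_wrt_map
      by (rule sorted_wrt_mono_rel[of _ "(\<ge>)"])
         (use bs puiseux_square_mono in \<open>auto simp: zero_less_puiseux_iff\<close>)
    then have "map (\<lambda>a. a\<^sup>2) bs = rs"
      using bs rs by (intro sorted_wrt_ge_unique) auto
    then have "map (\<lambda>a. a\<^sup>2) bs = map (\<lambda>a. a\<^sup>2) ts" using ts(2) by simp
    moreover have "inj_on (\<lambda>a. a\<^sup>2) (set bs \<union> set ts)"
      by (rule inj_onI) (use bs ts(1) puiseux_square_inj in \<open>auto simp: zero_less_puiseux_iff\<close>)
    ultimately show "bs = ts" by (rule map_inj_on)
  qed
  moreover have "puiseux_l (sq r) = 1 / 2 * puiseux_l r" if "r \<in> set rs" for r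
    using puiseux_l_power[of "sq r" 2] sq[OF pos[OF that]] puiseux_pos_nonzero by auto
  ultimately have "map puiseux_l (decreasing_sqrt_roots p) = map (\<lambda>r. 1 / 2 * puiseux_l r) rs"
    by (simp add: ts_def)
  with rs show thesis by (rule that)
qed

section \<open>Leading exponents of coefficients and roots\<close>

text \<open>
  Up to sign, the coefficients of \<open>\<Prod>(u - r)\<close> are the elementary symmetric polynomials in the roots,
  which are sums of positive terms.  So the leading exponent of the \<open>s\<close>-th one is the largest leading
  exponent of a product of \<open>s\<close> roots, and that is attained by the \<open>s\<close> largest roots.  The induction
  uses the recursion \<open>e\<^sub>s(r, rs) = r * e\<^bsub>s-1\<^esub>(rs) + e\<^sub>s(rs)\<close>, in which the first summand dominates
  because \<open>r\<close> is at least as large as every entry of \<open>rs\<close>.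
\<close>

lemma puiseux_pos_prod_coeff:
  assumes "sorted_wrt (\<ge>) rs" "\<And>r. r \<in> set rs \<Longrightarrow> puiseux_pos r" "s \<le> length rs"
  defines "c \<equiv> (-1) ^ s * coeff (\<Prod>r\<leftarrow>rs. [:- r, 1:]) (length rs - s)"
  shows "puiseux_pos c \<and> puiseux_l c = (\<Sum>r\<leftarrow>take s rs. puiseux_l r)"
  using assms(1-3) unfolding c_def
proof (induction rs arbitrary: s)
  case (Cons r rs)
  define q where "q = (\<Prod>r\<leftarrow>rs. [:- r, 1:])"
  \<comment> \<open>The elementary symmetric polynomial of degree \<open>s\<close> in \<open>rs\<close>.\<close>
  define D where "D = (\<lambda>s. (-1) ^ s * coeff q (length rs - s))"
  have IH: "puiseux_pos (D s)" "puiseux_l (D s) = (\<Sum>r\<leftarrow>take s rs. puiseux_l r)"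
    if "s \<le> length rs" for s
    using Cons.IH[of s] Cons.prems that by (auto simp: D_def q_def)
  have r: "puiseux_pos r" using Cons.prems by simp
  have mult: "(\<Prod>r\<leftarrow>r # rs. [:- r, 1:]) = pCons 0 q - Polynomial.smult r q"
    by (simp add: q_def)
  have high: "coeff q (Suc (length rs)) = 0"
  proof (rule coeff_eq_0)
    show "degree q < Suc (length rs)"
      using degree_prod_list_le[of "map (\<lambda>r. [:- r, 1:]) rs"] by (simp add: q_def o_def sum_list_triv)
  qed
  show ?case
  proof (cases s)
    case 0
    then have "(-1) ^ s * coeff (\<Prod>r\<leftarrow>r # rs. [:- r, 1:]) (length (r # rs) - s) = D 0"
      by (simp only: mult) (simp add: high D_def)
    then show ?thesis using IH[of 0] \<open>s = 0\<close> by simp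
  next
    case (Suc k)
    then have k: "k \<le> length rs" using Cons.prems by simp
    have rk: "puiseux_pos (r * D k)" "puiseux_l (r * D k) = (\<Sum>r\<leftarrow>take s (r # rs). puiseux_l r)"
      using r IH[OF k] by (simp_all add: Suc puiseux_pos_mult puiseux_mult_leading puiseux_pos_nonzero)
    show ?thesis
    proof (cases "k = length rs")
      case True
      then have "(-1) ^ s * coeff (\<Prod>r\<leftarrow>r # rs. [:- r, 1:]) (length (r # rs) - s) = r * D k"
        by (simp only: mult) (simp add: Suc D_def)
      then show ?thesis using rk by simp
    next
      case False
      then have k': "Suc k \<le> length rs" using k by simp
      have "length rs - k = Suc (length rs - Suc k)" using k' by simp
      then have "(-1) ^ s * coeff (\<Prod>r\<leftarrow>r # rs. [:- r, 1:]) (length (r # rs) - s) = r * D k + D (Suc k)"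
        by (simp only: mult) (simp add: Suc D_def algebra_simps)
      moreover have "puiseux_l (D (Suc k)) \<le> puiseux_l (r * D k)"
      proof -
        have "rs ! k \<le> r" "puiseux_pos (rs ! k)" using Cons.prems k' by auto
        then have "puiseux_l (rs ! k) \<le> puiseux_l r" by (intro puiseux_l_mono)
        then show ?thesis using IH[OF k'] rk(2) k' by (simp add: Suc take_Suc_conv_app_nth)
      qed
      ultimately show ?thesis
        using puiseux_pos_add[OF rk(1) IH(1)[OF k']] puiseux_l_add_pos[OF rk(1) IH(1)[OF k']] rk(2)
        by simp
    qed
  qed
qed simp

text \<open>
  By \<open>puiseux_pos_prod_coeff\<close>, \<open>puiseux_l (c s)\<close> exceeds \<open>puiseux_l (c 0)\<close> by the sum of the leading
  exponents of the \<open>s\<close> largest roots, so that successive differences recover those of the single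
  roots.
\<close>

lemma puiseux_l_decreasing_sqrt_roots:
  assumes deg: "degree q \<le> n" and c: "\<And>s. s \<le> n \<Longrightarrow> coeff q (n - s) = (-1) ^ s * c s"
    and c0: "c 0 \<noteq> 0" and roots: "\<And>u. poly q u = 0 \<Longrightarrow> puiseux_pos u"
  shows "map puiseux_l (decreasing_sqrt_roots q) =
    map (\<lambda>s. 1 / 2 * (puiseux_l (c (s + 1)) - puiseux_l (c s))) [0..<n]"
proof -
  have cn: "coeff q n = c 0" using c[of 0] by simp
  then have degq: "degree q = n" using deg c0 by (simp add: antisym le_degree)
  have q0: "q \<noteq> 0" using cn c0 by auto
  obtain A where A: "size A = n" "q = Polynomial.smult (c 0) (\<Prod>x\<in>#A. [:- x, 1:])"
    using alg_closed_imp_factorization[OF q0] cn degq by metis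
  have "proots (\<Prod>x\<in>#A. [:- x, 1:]) = A"
  proof (induction A)
    case (add x A)
    have "(\<Prod>x\<in>#A. [:- x, 1:]) \<noteq> 0" by (auto simp: prod_mset_zero_iff)
    then have "proots ([:- x, 1:] * (\<Prod>x\<in>#A. [:- x, 1:])) = {#x#} + A"
      using add by (subst proots_mult) simp_all
    then show ?case by simp
  qed simp
  then have prA: "proots q = A" using A(2) c0 by simp
  have pos: "puiseux_pos r" if "r \<in># proots q" for r
    using that q0 by (intro roots) simp
  obtain rs where rs: "sorted_wrt (\<ge>) rs" "mset rs = proots q"
    "map puiseux_l (decreasing_sqrt_roots q) = map (\<lambda>r. 1 / 2 * puiseux_l r) rs"
    using decreasing_sqrt_roots_squares pos by metis
  have len: "length rs = n" using rs(2) A(1) by (metis prA size_mset)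
  have posrs: "puiseux_pos r" if "r \<in> set rs" for r
    using that pos rs(2) by (metis set_mset_mset)
  have q: "q = Polynomial.smult (c 0) (\<Prod>r\<leftarrow>rs. [:- r, 1:])"
    using A(2) by (simp only: rs(2)[unfolded prA, symmetric] mset_map[symmetric] prod_mset_prod_list)
  have lc: "puiseux_l (c s) = puiseux_l (c 0) + (\<Sum>r\<leftarrow>take s rs. puiseux_l r)" if "s \<le> n" for s
  proof -
    let ?d = "(-1) ^ s * coeff (\<Prod>r\<leftarrow>rs. [:- r, 1:]) (length rs - s)"
    have d: "puiseux_pos ?d \<and> puiseux_l ?d = (\<Sum>r\<leftarrow>take s rs. puiseux_l r)"
      using puiseux_pos_prod_coeff[OF rs(1) posrs] that len by simp
    have "c s = (-1) ^ s * ((-1) ^ s * c s)" by (simp flip: power_add mult.assoc mult_2)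
    also have "\<dots> = (-1) ^ s * coeff q (n - s)" using c[OF that] by simp
    also have "\<dots> = c 0 * ?d" by (subst q) (simp add: len)
    finally have "c s = c 0 * ?d" .
    then show ?thesis using d c0 puiseux_pos_nonzero puiseux_mult_leading(1) by metis
  qed
  have "map (\<lambda>r. 1 / 2 * puiseux_l r) rs =
      map (\<lambda>s. 1 / 2 * (puiseux_l (c (s + 1)) - puiseux_l (c s))) [0..<n]"
  proof (rule nth_equalityI)
    fix i assume "i < length (map (\<lambda>r. 1 / 2 * puiseux_l r) rs)"
    then have i: "i < n" by (simp add: len)
    then show "map (\<lambda>r. 1 / 2 * puiseux_l r) rs ! i =
      map (\<lambda>s. 1 / 2 * (puiseux_l (c (s + 1)) - puiseux_l (c s))) [0..<n] ! i"
      using lc[of i] lc[of "Suc i"] by (simp add: len take_Suc_conv_app_nth)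
  qed (simp add: len)
  with rs(3) show ?thesis by simp
qed

section \<open>Restricting a determinantal polynomial to the coordinate lines\<close>

lemma comm_ring_hom_poly_map_poly:
  assumes "comm_ring_hom f"
  shows "comm_ring_hom (\<lambda>F. poly (map_poly f F) c)"
proof -
  interpret f: comm_ring_hom f by fact
  interpret m: map_poly_comm_ring_hom f ..
  show ?thesis by unfold_locales (simp_all add: m.hom_add m.hom_mult)
qed

lemma comm_ring_hom_subst3: "comm_ring_hom (\<lambda>F. subst3 F a b c)"
  unfolding subst3_def
  by (intro comm_ring_hom_poly_map_poly pcompose_hom.comm_ring_hom_axioms)

lemma subst3_const3: "subst3 (const3 k) a b c = [:k:]"
  by (simp add: subst3_def const3_def Polynomial.map_poly_pCons)

lemma subst3_vars:
  "subst3 var_x a b c = a" "subst3 var_y a b c = b" "subst3 var_z a b c = c"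
  by (simp_all add: subst3_def var_x_def var_y_def var_z_def map_poly_pCons pcompose_pCons)

text \<open>
  Substitution is a ring homomorphism and therefore commutes with the determinant.
\<close>

lemma poly_subst3_det_pencil:
  assumes "X \<in> carrier_mat n n" "Y \<in> carrier_mat n n" "Z \<in> carrier_mat n n"
  shows "poly (subst3 (Determinant.det (pencil X Y Z)) a b c) u =
    Determinant.det (poly a u \<cdot>\<^sub>m X + poly b u \<cdot>\<^sub>m Y + poly c u \<cdot>\<^sub>m Z)"
proof -
  interpret s: comm_ring_hom "\<lambda>F. subst3 F a b c" by (rule comm_ring_hom_subst3)
  have "poly (subst3 (Determinant.det (pencil X Y Z)) a b c) u =
      Determinant.det (map_mat (\<lambda>p. poly p u) (map_mat (\<lambda>F. subst3 F a b c) (pencil X Y Z)))"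
    by (simp only: comm_ring_hom.hom_det[OF poly_hom.comm_ring_hom_axioms] s.hom_det)
  also have "map_mat (\<lambda>p. poly p u) (map_mat (\<lambda>F. subst3 F a b c) (pencil X Y Z)) =
      poly a u \<cdot>\<^sub>m X + poly b u \<cdot>\<^sub>m Y + poly c u \<cdot>\<^sub>m Z"
    using assms
    by (intro eq_matI) (auto simp: pencil_def s.hom_add s.hom_mult subst3_const3 subst3_vars)
  finally show ?thesis .
qed

lemma poly_map_poly_eq_sum:
  fixes f :: "'a::zero \<Rightarrow> 'b::comm_semiring_1"
  assumes "f 0 = 0" "degree p \<le> n"
  shows "poly (map_poly f p) x = (\<Sum>i\<le>n. f (coeff p i) * x ^ i)"
proof -
  have "degree (map_poly f p) \<le> n"
    using assms(2) degree_map_poly_le order_trans by blast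
  then have "(\<Sum>i\<le>degree (map_poly f p). coeff (map_poly f p) i * x ^ i) =
      (\<Sum>i\<le>n. coeff (map_poly f p) i * x ^ i)"
    by (intro sum.mono_neutral_left) (auto simp: coeff_eq_0)
  then show ?thesis by (simp add: poly_altdef coeff_map_poly assms(1))
qed

lemma subst3_homogeneous:
  assumes hom: "\<And>i j k. coeff3 F i j k \<noteq> 0 \<Longrightarrow> i + j + k = n"
  shows "subst3 F a b c =
    (\<Sum>(i, j, k)\<in>{(i, j, k). i + j + k = n}. Polynomial.smult (coeff3 F i j k) (a ^ i * b ^ j * c ^ k))"
proof -
  have z: "coeff (coeff (coeff F k) j) i = 0" if "i + j + k \<noteq> n" for i j k
    using hom[of i j k] that by (auto simp: coeff3_def)
  have d1: "degree (coeff (coeff F k) j) \<le> n" for j k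
    by (rule degree_le) (auto intro!: z)
  have d2: "degree (coeff F k) \<le> n" for k
    by (rule degree_le) (auto intro!: poly_eqI z)
  have d3: "degree F \<le> n"
    by (rule degree_le) (auto intro!: poly_eqI z)
  have e1: "pcompose h a = (\<Sum>i\<le>n. Polynomial.smult (coeff h i) (a ^ i))" if "degree h \<le> n" for h
    using that by (simp add: pcompose_altdef poly_map_poly_eq_sum)
  have e2: "poly (map_poly (\<lambda>h. pcompose h a) G) b =
      (\<Sum>j\<le>n. pcompose (coeff G j) a * b ^ j)" if "degree G \<le> n" for G
    using that by (simp add: poly_map_poly_eq_sum)
  have "subst3 F a b c = (\<Sum>k\<le>n. poly (map_poly (\<lambda>h. pcompose h a) (coeff F k)) b * c ^ k)"
    unfolding subst3_def using d3 by (simp add: poly_map_poly_eq_sum)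
  also have "\<dots> = (\<Sum>k\<le>n. \<Sum>j\<le>n. \<Sum>i\<le>n. Polynomial.smult (coeff3 F i j k) (a ^ i * b ^ j * c ^ k))"
    by (simp add: e2[OF d2] e1[OF d1] coeff3_def sum_distrib_right mult.assoc)
  also have "\<dots> = (\<Sum>(k, j, i)\<in>{..n} \<times> {..n} \<times> {..n}.
      Polynomial.smult (coeff3 F i j k) (a ^ i * b ^ j * c ^ k))"
    by (simp add: sum.cartesian_product)
  also have "\<dots> = (\<Sum>(i, j, k)\<in>{(i, j, k). i + j + k = n}.
      Polynomial.smult (coeff3 F i j k) (a ^ i * b ^ j * c ^ k))"
    by (rule sum.reindex_bij_witness_not_neutral[where S' = "{..n} \<times> {..n} \<times> {..n} - {(k, j, i). i + j + k = n}" and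
          T' = "{}" and i = "\<lambda>(i, j, k). (k, j, i)" and j = "\<lambda>(k, j, i). (i, j, k)"])
       (use z in \<open>auto simp: coeff3_def\<close>)
  finally show ?thesis .
qed

lemma finite_triples: "finite {(i, j, k). i + j + k = (n::nat)}"
  by (rule finite_subset[of _ "{..n} \<times> {..n} \<times> {..n}"]) auto

text \<open>
  If one variable is set to zero, only the monomials on one side of the triangle of exponents remain.
\<close>

lemma subst3_homogeneous_sides:
  assumes hom: "\<And>i j k. coeff3 F i j k \<noteq> 0 \<Longrightarrow> i + j + k = n"
  shows "subst3 F a b 0 = (\<Sum>s\<le>n. Polynomial.smult (coeff3 F (n - s) s 0) (a ^ (n - s) * b ^ s))"
    and "subst3 F 0 a b = (\<Sum>s\<le>n. Polynomial.smult (coeff3 F 0 (n - s) s) (a ^ (n - s) * b ^ s))"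
    and "subst3 F b 0 a = (\<Sum>s\<le>n. Polynomial.smult (coeff3 F s 0 (n - s)) (a ^ (n - s) * b ^ s))"
proof -
  let ?T = "{(i, j, k). i + j + k = n}"
  show "subst3 F a b 0 = (\<Sum>s\<le>n. Polynomial.smult (coeff3 F (n - s) s 0) (a ^ (n - s) * b ^ s))"
  proof -
    have "subst3 F a b 0 =
        (\<Sum>(i, j, k)\<in>?T. Polynomial.smult (coeff3 F i j k) (a ^ i * b ^ j * 0 ^ k))"
      by (rule subst3_homogeneous[OF hom])
    also have "\<dots> = (\<Sum>(i, j, k)\<in>?T \<inter> {(i, j, k). k = 0}. Polynomial.smult (coeff3 F i j k) (a ^ i * b ^ j * 0 ^ k))"
      by (rule sum.mono_neutral_right) (auto simp: finite_triples power_0_left split: if_splits)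
    also have "\<dots> = (\<Sum>s\<le>n. Polynomial.smult (coeff3 F (n - s) s 0) (a ^ (n - s) * b ^ s))"
      by (rule sum.reindex_bij_witness[of _ "\<lambda>s. (n - s, s, 0)" "\<lambda>(i, j, k). j"]) (auto simp: mult.commute)
    finally show ?thesis .
  qed
  show "subst3 F 0 a b = (\<Sum>s\<le>n. Polynomial.smult (coeff3 F 0 (n - s) s) (a ^ (n - s) * b ^ s))"
  proof -
    have "subst3 F 0 a b =
        (\<Sum>(i, j, k)\<in>?T. Polynomial.smult (coeff3 F i j k) (0 ^ i * a ^ j * b ^ k))"
      by (rule subst3_homogeneous[OF hom])
    also have "\<dots> = (\<Sum>(i, j, k)\<in>?T \<inter> {(i, j, k). i = 0}. Polynomial.smult (coeff3 F i j k) (0 ^ i * a ^ j * b ^ k))"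
      by (rule sum.mono_neutral_right) (auto simp: finite_triples power_0_left split: if_splits)
    also have "\<dots> = (\<Sum>s\<le>n. Polynomial.smult (coeff3 F 0 (n - s) s) (a ^ (n - s) * b ^ s))"
      by (rule sum.reindex_bij_witness[of _ "\<lambda>s. (0, n - s, s)" "\<lambda>(i, j, k). k"]) (auto simp: mult.commute)
    finally show ?thesis .
  qed
  show "subst3 F b 0 a = (\<Sum>s\<le>n. Polynomial.smult (coeff3 F s 0 (n - s)) (a ^ (n - s) * b ^ s))"
  proof -
    have "subst3 F b 0 a =
        (\<Sum>(i, j, k)\<in>?T. Polynomial.smult (coeff3 F i j k) (b ^ i * 0 ^ j * a ^ k))"
      by (rule subst3_homogeneous[OF hom])
    also have "\<dots> = (\<Sum>(i, j, k)\<in>?T \<inter> {(i, j, k). j = 0}. Polynomial.smult (coeff3 F i j k) (b ^ i * 0 ^ j * a ^ k))"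
      by (rule sum.mono_neutral_right) (auto simp: finite_triples power_0_left split: if_splits)
    also have "\<dots> = (\<Sum>s\<le>n. Polynomial.smult (coeff3 F s 0 (n - s)) (a ^ (n - s) * b ^ s))"
      by (rule sum.reindex_bij_witness[of _ "\<lambda>s. (s, 0, n - s)" "\<lambda>(i, j, k). i"]) (auto simp: mult.commute)
    finally show ?thesis .
  qed
qed

lemma smult_mat_vec:
  fixes A :: "'a::comm_semiring_0 mat"
  assumes "A \<in> carrier_mat m n" "v \<in> carrier_vec n"
  shows "(k \<cdot>\<^sub>m A) *\<^sub>v v = k \<cdot>\<^sub>v (A *\<^sub>v v)"
  using assms by (intro eq_vecI) auto

text \<open>
  The values \<open>\<alpha>\<close>, \<open>\<beta>\<close> are those of the two Hermitian forms at a vector in the kernel.  In particular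
  the zeros of \<open>det (u P - Q)\<close> are quotients \<open>\<beta> / \<alpha>\<close> of positive series, and \<open>det P\<close> does not vanish.
\<close>

lemma positive_definite_pencil_singular:
  fixes P Q :: "puiseux mat"
  assumes "positive_definite n P" "positive_definite n Q"
    and det: "Determinant.det (x \<cdot>\<^sub>m P + y \<cdot>\<^sub>m Q) = 0"
  obtains \<alpha> \<beta> where "puiseux_pos \<alpha>" "puiseux_pos \<beta>" "x * \<alpha> + y * \<beta> = 0"
proof -
  have P: "P \<in> carrier_mat n n" and Q: "Q \<in> carrier_mat n n"
    using assms by (auto simp: positive_definite_def)
  have "x \<cdot>\<^sub>m P + y \<cdot>\<^sub>m Q \<in> carrier_mat n n" using P Q by simp
  from det_0_iff_vec_prod_zero_field[OF this] det
  obtain v where v: "v \<in> carrier_vec n" "v \<noteq> 0\<^sub>v n" "(x \<cdot>\<^sub>m P + y \<cdot>\<^sub>m Q) *\<^sub>v v = 0\<^sub>v n"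
    by auto
  have "(x \<cdot>\<^sub>m P + y \<cdot>\<^sub>m Q) *\<^sub>v v = x \<cdot>\<^sub>v (P *\<^sub>v v) + y \<cdot>\<^sub>v (Q *\<^sub>v v)"
    using P Q v(1) by (simp add: add_mult_distrib_mat_vec[of _ n n] smult_mat_vec)
  then have "x \<cdot>\<^sub>v (P *\<^sub>v v) + y \<cdot>\<^sub>v (Q *\<^sub>v v) = 0\<^sub>v n"
    by (rule trans[OF sym, OF _ v(3)])
  then have "0 = (x \<cdot>\<^sub>v (P *\<^sub>v v) + y \<cdot>\<^sub>v (Q *\<^sub>v v)) \<bullet>c v"
    using v(1) by (simp only: scalar_prod_left_zero carrier_vec_conjugate)
  also have "\<dots> = x * ((P *\<^sub>v v) \<bullet>c v) + y * ((Q *\<^sub>v v) \<bullet>c v)"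
    using P Q v(1) by (subst add_scalar_prod_distrib[of _ n]) auto
  finally have "x * ((P *\<^sub>v v) \<bullet>c v) + y * ((Q *\<^sub>v v) \<bullet>c v) = 0" ..
  moreover have "puiseux_pos ((P *\<^sub>v v) \<bullet>c v)" "puiseux_pos ((Q *\<^sub>v v) \<bullet>c v)"
    using assms(1,2) v by (auto simp: positive_definite_def zero_less_puiseux_iff)
  ultimately show thesis using that by blast
qed

text \<open>
  The common form of the three boundary components: \<open>\<Phi> a b\<close> is the restriction of a determinantal
  polynomial to one of the three coordinate lines, as a binary form with coefficients \<open>f\<close>, evaluated
  at \<open>(a, b)\<close>.
\<close>

lemma puiseux_l_decreasing_sqrt_roots_pencil:
  fixes \<Phi> :: "puiseux poly \<Rightarrow> puiseux poly \<Rightarrow> puiseux poly"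
  assumes PQ: "positive_definite n P" "positive_definite n Q"
    and det: "\<And>a b u. poly (\<Phi> a b) u = Determinant.det (poly a u \<cdot>\<^sub>m P + poly b u \<cdot>\<^sub>m Q)"
    and sum: "\<And>a b. \<Phi> a b = (\<Sum>s\<le>n. Polynomial.smult (f s) (a ^ (n - s) * b ^ s))"
  shows "map puiseux_l (decreasing_sqrt_roots (\<Phi> [:0, 1:] (-1))) =
    map (\<lambda>s. 1 / 2 * (puiseux_l (f (s + 1)) - puiseux_l (f s))) [0..<n]"
proof (rule puiseux_l_decreasing_sqrt_roots)
  have "\<Phi> [:0, 1:] (-1) = (\<Sum>s\<le>n. monom ((-1) ^ s * f s) (n - s))"
  proof -
    have "Polynomial.smult (f s) ([:0, 1:] ^ (n - s) * (-1) ^ s) = monom ((-1) ^ s * f s) (n - s)" for s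
      by (cases "even s") (simp_all add: monom_altdef)
    then show ?thesis by (simp add: sum)
  qed
  also have "\<dots> = (\<Sum>j\<le>n. monom ((-1) ^ (n - j) * f (n - j)) j)"
    by (rule sum.reindex_bij_witness[of _ "\<lambda>j. n - j" "\<lambda>j. n - j"]) auto
  finally have \<Phi>: "\<Phi> [:0, 1:] (-1) = (\<Sum>j\<le>n. monom ((-1) ^ (n - j) * f (n - j)) j)" .
  show "degree (\<Phi> [:0, 1:] (-1)) \<le> n"
    unfolding \<Phi> by (rule degree_le) (simp add: coeff_sum_monom)
  show "coeff (\<Phi> [:0, 1:] (-1)) (n - s) = (-1) ^ s * f s" if "s \<le> n" for s
    unfolding \<Phi> coeff_sum_monom using that by simp
  \<comment> \<open>The coefficient \<open>f 0\<close> is the value \<open>det P\<close> of the form at \<open>(1, 0)\<close>.\<close>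
  have "\<Phi> 1 0 = (\<Sum>s\<in>{0}. Polynomial.smult (f s) (1 ^ (n - s) * 0 ^ s))"
    unfolding sum by (rule sum.mono_neutral_right) (auto simp: power_0_left)
  then have "f 0 = poly (\<Phi> 1 0) 0" by simp
  show "f 0 \<noteq> 0"
  proof
    assume "f 0 = 0"
    then have "Determinant.det (1 \<cdot>\<^sub>m P + 0 \<cdot>\<^sub>m Q) = 0"
      using \<open>f 0 = poly (\<Phi> 1 0) 0\<close> by (simp add: det)
    then obtain \<alpha> \<beta> where "puiseux_pos \<alpha>" "1 * \<alpha> + 0 * \<beta> = 0"
      by (rule positive_definite_pencil_singular[OF PQ])
    then show False using puiseux_pos_nonzero by simp
  qed
  show "puiseux_pos u" if "poly (\<Phi> [:0, 1:] (-1)) u = 0" for u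
  proof -
    have "Determinant.det (u \<cdot>\<^sub>m P + (- 1) \<cdot>\<^sub>m Q) = 0" using that by (simp add: det)
    then obtain \<alpha> \<beta> where ab: "puiseux_pos \<alpha>" "puiseux_pos \<beta>" "u * \<alpha> + - 1 * \<beta> = 0"
      by (rule positive_definite_pencil_singular[OF PQ])
    then have "u = \<beta> * inverse \<alpha>" using puiseux_pos_nonzero by (simp add: field_simps)
    then show ?thesis using ab by (simp add: puiseux_pos_mult puiseux_pos_inverse)
  qed
qed

theorem proposition11:
  fixes n :: nat and F :: "puiseux poly3"
  assumes "F \<in> H_polys n"
  shows "map_triple puiseux_l (boundary F) =
    map_triple (\<lambda>q. 1 / 2 * q) (hive_boundary n (\<lambda>i j k. puiseux_l (coeff3 F i j k)))"
proof -
  have hom: "\<And>i j k. coeff3 F i j k \<noteq> 0 \<Longrightarrow> i + j + k = n"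
    using assms by (simp add: H_polys_def)
  obtain X Y Z where XYZ: "positive_definite n X" "positive_definite n Y" "positive_definite n Z"
    and F: "F = Determinant.det (pencil X Y Z)"
    using assms by (auto simp: H_polys_def)
  have carrier: "X \<in> carrier_mat n n" "Y \<in> carrier_mat n n" "Z \<in> carrier_mat n n"
    using XYZ by (auto simp: positive_definite_def)
  note det = poly_subst3_det_pencil[OF carrier, folded F]
  have drop: "x \<cdot>\<^sub>m X + y \<cdot>\<^sub>m Y + 0 \<cdot>\<^sub>m Z = x \<cdot>\<^sub>m X + y \<cdot>\<^sub>m Y"
    "0 \<cdot>\<^sub>m X + x \<cdot>\<^sub>m Y + y \<cdot>\<^sub>m Z = x \<cdot>\<^sub>m Y + y \<cdot>\<^sub>m Z"
    "y \<cdot>\<^sub>m X + 0 \<cdot>\<^sub>m Y + x \<cdot>\<^sub>m Z = x \<cdot>\<^sub>m Z + y \<cdot>\<^sub>m X" for x y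
    using carrier by (auto intro!: eq_matI simp: add.commute)
  have "map puiseux_l (decreasing_sqrt_roots (subst3 F [:0, 1:] (- 1) 0)) =
      map (\<lambda>s. 1 / 2 * (puiseux_l (coeff3 F (n - (s + 1)) (s + 1) 0) - puiseux_l (coeff3 F (n - s) s 0))) [0..<n]"
    by (rule puiseux_l_decreasing_sqrt_roots_pencil[OF XYZ(1,2), of "\<lambda>a b. subst3 F a b 0"])
       (simp add: det drop, rule subst3_homogeneous_sides[OF hom])
  moreover have "map puiseux_l (decreasing_sqrt_roots (subst3 F 0 [:0, 1:] (- 1))) =
      map (\<lambda>s. 1 / 2 * (puiseux_l (coeff3 F 0 (n - (s + 1)) (s + 1)) - puiseux_l (coeff3 F 0 (n - s) s))) [0..<n]"
    by (rule puiseux_l_decreasing_sqrt_roots_pencil[OF XYZ(2,3), of "\<lambda>a b. subst3 F 0 a b"])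
       (simp add: det drop, rule subst3_homogeneous_sides[OF hom])
  moreover have "map puiseux_l (decreasing_sqrt_roots (subst3 F (- 1) 0 [:0, 1:])) =
      map (\<lambda>s. 1 / 2 * (puiseux_l (coeff3 F (s + 1) 0 (n - (s + 1))) - puiseux_l (coeff3 F s 0 (n - s)))) [0..<n]"
    by (rule puiseux_l_decreasing_sqrt_roots_pencil[OF XYZ(3,1), of "\<lambda>a b. subst3 F b 0 a"])
       (simp add: det drop, rule subst3_homogeneous_sides[OF hom])
  ultimately show ?thesis
    by (simp add: boundary_def hive_boundary_def map_triple_def Let_def o_def)
qed

end
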